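(* For every $\bar H\in\mathbb{R}$ one can find a constant $C(\bar H)>0$ depending only on $\bar H$ such that for all $f=f(v)\ge 0$ on $\mathbb{R}^3$ satisfying the normalization $$\int_{\mathbb{R}^3} f(v)\,dv=1,\qquad \int_{\mathbb{R}^3} f(v)\,v\,dv=0,\qquad \int_{\mathbb{R}^3} f(v)\,|v|^2\,dv=3,$$ and the entropy bound $$H(f):=\int_{\mathbb{R}^3} f(v)\log f(v)\,dv\le \bar H,$$ the following inequality holds: $$D(f)\ \ge\ C(\bar H)\,\big(M_5(f)\big)^{-1}\int_{\mathbb{R}^3} f(v)\,\left|\frac{\nabla f(v)}{f(v)}+v\right|^2\langle v\rangle^{-3}\,dv .$$
   Context: Notation: $\langle v\rangle=(1+|v|^2)^{1/2}$ and $M_\ell(f)=\int_{\mathbb{R}^3}\langle v\rangle^{\ell} f(v)\,dv$. The entropy dissipation of the Landau operator with Coulomb potential is $$D(f)=\frac12\sum_{i=1}^3\sum_{j=1}^3\iint_{\mathbb{R}^3\times\mathbb{R}^3} a_{ij}(v-w)\left\{\frac{\partial_i f}{f}(v)-\frac{\partial_i f}{f}(w)\right\}\left\{\frac{\partial_j f}{f}(v)-\frac{\partial_j f}{f}(w)\right\} f(v)f(w)\,dv\,dw,$$ where $a_{ij}(z)=|z|^{-1}\Pi_{ij}(z)$ and $\Pi_{ij}(z)=\delta_{ij}-\frac{z_iz_j}{|z|^2}$. *)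

theory Defs
  imports "HOL-Analysis.Analysis"
begin

text \<open>
  Functions on \<open>\<real>\<^sup>3\<close> are represented by Borel measurable representatives, and their first derivatives
  are understood in the weak sense.  Test functions range over \<open>C\<^sup>1\<close> functions with compact support;
  for locally integrable functions, mollification shows this to be equivalent to testing with smooth
  functions.  A continuously differentiable function has its classical gradient as weak gradient.
\<close>

definition has_weak_gradient :: "('a::euclidean_space \<Rightarrow> real) \<Rightarrow> ('a \<Rightarrow> 'a) \<Rightarrow> bool"
  where "has_weak_gradient f g \<longleftrightarrow>
    f \<in> borel_measurable borel \<and> g \<in> borel_measurable borel \<and>
    (\<forall>K. compact K \<longrightarrow> set_integrable lborel K f \<and> set_integrable lborel K g) \<and>
    (\<forall>\<phi> \<phi>'. (\<forall>x. GDERIV \<phi> x :> \<phi>' x) \<and> continuous_on UNIV \<phi>' \<and> compact (closure {x. \<phi> x \<noteq> 0}) \<longrightarrow>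
       (\<integral>x. f x *\<^sub>R \<phi>' x \<partial>lborel) = - (\<integral>x. \<phi> x *\<^sub>R g x \<partial>lborel))"

definition japanese_bracket :: "'a::real_normed_vector \<Rightarrow> real"
  where "japanese_bracket v = sqrt (1 + (norm v)\<^sup>2)"

definition weighted_moment :: "real \<Rightarrow> (real^3 \<Rightarrow> real) \<Rightarrow> ennreal"
  where "weighted_moment l f = (\<integral>\<^sup>+v. ennreal (japanese_bracket v powr l * f v) \<partial>lborel)"

definition proj_perp :: "real^3 \<Rightarrow> real^3^3"
  where "proj_perp z = (\<chi> i j. (if i = j then 1 else 0) - z $ i * z $ j / (norm z)\<^sup>2)"

definition coulomb_matrix :: "real^3 \<Rightarrow> real^3^3"
  where "coulomb_matrix z = (\<chi> i j. inverse (norm z) * proj_perp z $ i $ j)"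

text \<open>
  The finiteness of \<open>\<integral> f log f\<close> is part of the entropy bound; where \<open>f\<close> vanishes the integrand is \<open>0\<close>.
\<close>

definition entropy_le :: "(real^3 \<Rightarrow> real) \<Rightarrow> real \<Rightarrow> bool"
  where "entropy_le f Hbar \<longleftrightarrow>
    integrable lborel (\<lambda>v. f v * ln (f v)) \<and> (\<integral>v. f v * ln (f v) \<partial>lborel) \<le> Hbar"

text \<open>
  In the two functionals below, \<open>g\<close> stands for the gradient of \<open>f\<close>.  Both take values in \<open>[0, \<infinity>]\<close>, and
  points where \<open>f\<close> vanishes do not contribute.  The integrand of the dissipation is the whole
  quadratic form, which is nonnegative (lemma \<open>landau_integrand_nonneg\<close>), whereas its separate
  \<open>(i, j)\<close> terms need not be.
\<close>

definition landau_integrand :: "(real^3 \<Rightarrow> real) \<Rightarrow> (real^3 \<Rightarrow> real^3) \<Rightarrow> real^3 \<Rightarrow> real^3 \<Rightarrow> real"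
  where "landau_integrand f g v w =
    (\<Sum>i\<in>UNIV. \<Sum>j\<in>UNIV. coulomb_matrix (v - w) $ i $ j
        * (g v $ i / f v - g w $ i / f w) * (g v $ j / f v - g w $ j / f w) * f v * f w)"

definition entropy_dissipation :: "(real^3 \<Rightarrow> real) \<Rightarrow> (real^3 \<Rightarrow> real^3) \<Rightarrow> ennreal"
  where "entropy_dissipation f g =
    ennreal (1 / 2) * (\<integral>\<^sup>+(v, w). ennreal (landau_integrand f g v w) \<partial>(lborel \<Otimes>\<^sub>M lborel))"

definition weighted_relative_fisher :: "(real^3 \<Rightarrow> real) \<Rightarrow> (real^3 \<Rightarrow> real^3) \<Rightarrow> ennreal"
  where "weighted_relative_fisher f g =
    (\<integral>\<^sup>+v. ennreal (f v * (norm (g v /\<^sub>R f v + v))\<^sup>2 * japanese_bracket v powr (-3)) \<partial>lborel)"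

lemma coulomb_form_nonneg:
  "(\<Sum>i\<in>UNIV. \<Sum>j\<in>UNIV. coulomb_matrix z $ i $ j * x $ i * x $ j) \<ge> 0"
proof (cases "z = 0")
  case True
  then show ?thesis by (simp add: coulomb_matrix_def)
next
  case False
  have "(\<Sum>i\<in>UNIV. \<Sum>j\<in>UNIV. coulomb_matrix z $ i $ j * x $ i * x $ j)
      = inverse (norm z) * ((x \<bullet> x) - (z \<bullet> x)\<^sup>2 / (norm z)\<^sup>2)"
    unfolding coulomb_matrix_def proj_perp_def inner_vec_def sum_3
    by (simp add: algebra_simps power2_eq_square add_divide_distrib)
  moreover have "(z \<bullet> x)\<^sup>2 / (norm z)\<^sup>2 \<le> x \<bullet> x"
    using Cauchy_Schwarz_ineq[of z x] False
    by (simp add: divide_le_eq power2_norm_eq_inner mult.commute)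
  ultimately show ?thesis by simp
qed

lemma landau_integrand_nonneg:
  assumes "\<And>v. f v \<ge> 0"
  shows "landau_integrand f g v w \<ge> 0"
proof -
  define x where "x = (\<chi> i. g v $ i / f v - g w $ i / f w)"
  have "landau_integrand f g v w
      = (\<Sum>i\<in>UNIV. \<Sum>j\<in>UNIV. coulomb_matrix (v - w) $ i $ j * x $ i * x $ j) * (f v * f w)"
    by (simp add: landau_integrand_def x_def sum_distrib_right mult.assoc)
  then show ?thesis
    using coulomb_form_nonneg[of "v - w" x] assms by simp
qed

end

theory Submission
  imports Defs "HOL-Probability.Distributions"
begin

text \<open>
  Write \<open>F = \<nabla>f / f\<close> for the score, \<open>z = v - w\<close> and \<open>b = F(v) - F(w)\<close>.  Since \<open>\<Pi>(z)\<close> projects onto the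
  plane orthogonal to \<open>z\<close>, the integrand of the dissipation is \<open>|z|\<^sup>-\<^sup>3\<close> times the squared norm of the
  bivector \<open>z \<and> b\<close>, and so it dominates the square of each component
  \<open>(z \<bullet> p) (b \<bullet> q) - (z \<bullet> q) (b \<bullet> p)\<close> with \<open>p, q\<close> orthonormal (\<open>landau_integrand_ge\<close>).

  The idea is that such a component, integrated in \<open>w\<close> against \<open>(w \<bullet> q) f(w)\<close>, no longer contains \<open>F(w)\<close>:
  that term becomes \<open>\<nabla>f(w)\<close> times a polynomial, and integration by parts together with the normalization
  of \<open>f\<close> evaluates it.  If \<open>p, q\<close> are distinct axes of a basis diagonalizing the second moments of \<open>f\<close>,
  and \<open>T\<^sub>q\<close> is the second moment along \<open>q\<close>, what remains is the residual \<open>T\<^sub>q (F(v) \<bullet> p) + v \<bullet> p\<close>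
  (\<open>wedge_pairing_tendsto\<close>).  The Cauchy-Schwarz inequality with weight \<open>|z|\<^sup>3\<close> then bounds all residuals
  in the weighted \<open>L\<^sup>2\<close> norm by \<open>M\<^sub>5 D\<close> (\<open>score_deviation_integrated\<close>); the factor \<open>|z|\<^sup>3 |w|\<^sup>2\<close> is what
  produces both the fifth moment and the weight \<open>\<langle>v\<rangle>\<^sup>-\<^sup>3\<close>.

  To pass from the residuals to \<open>F + v\<close> one has to know that the \<open>T\<^sub>q\<close> are close to \<open>1\<close>.  Eliminating the
  score between the two residuals that share the axis \<open>p\<close> leaves \<open>(T\<^sub>q - T\<^sub>r) (v \<bullet> p)\<close>, and the entropy
  bound prevents \<open>f\<close> from concentrating near the plane orthogonal to \<open>p\<close> (\<open>nondegeneracy_le\<close>).  Hence all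
  differences \<open>T\<^sub>q - T\<^sub>r\<close> are controlled by the dissipation.  The trace of the second moments is \<open>3\<close>, so
  each \<open>T\<^sub>q - 1\<close> is controlled as well (\<open>fisher_coordinate_le\<close>).

  The integration by parts is done with compactly supported cutoffs, because \<open>\<nabla>f\<close> need not be
  integrable at infinity.  The identity \<open>f F = \<nabla>f\<close> holds at first only where \<open>f > 0\<close>; on the zero set
  of \<open>f\<close> it rests on \<open>weak_gradient_zero_on_zero_set\<close>.
\<close>

section \<open>Test functions and their density\<close>

definition test_function :: "('a::euclidean_space \<Rightarrow> real) \<Rightarrow> ('a \<Rightarrow> 'a) \<Rightarrow> bool"
  where "test_function \<phi> \<phi>' \<longleftrightarrow>
    (\<forall>x. GDERIV \<phi> x :> \<phi>' x) \<and> continuous_on UNIV \<phi>' \<and> compact (closure {x. \<phi> x \<noteq> 0})"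

lemma weak_gradient_test:
  assumes "has_weak_gradient f g" "test_function \<phi> \<phi>'"
  shows "(\<integral>x. f x *\<^sub>R \<phi>' x \<partial>lborel) = - (\<integral>x. \<phi> x *\<^sub>R g x \<partial>lborel)"
  using assms unfolding has_weak_gradient_def test_function_def by blast

lemma GDERIV_continuous_on:
  assumes "\<And>x. GDERIV \<phi> x :> \<phi>' x"
  shows "continuous_on UNIV \<phi>"
  using assms unfolding gderiv_def
  by (meson continuous_at_imp_continuous_on has_derivative_continuous)

lemma test_function_continuous:
  assumes "test_function \<phi> \<phi>'"
  shows "continuous_on UNIV \<phi>" "continuous_on UNIV \<phi>'"
    and "\<phi> \<in> borel_measurable borel" "\<phi>' \<in> borel_measurable borel"
  using assms GDERIV_continuous_on unfolding test_function_def
  by (blast intro: borel_measurable_continuous_onI)+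

lemma compact_support_cball:
  fixes \<phi> :: "'a::euclidean_space \<Rightarrow> 'b::zero"
  assumes "\<And>x. norm x > R \<Longrightarrow> \<phi> x = 0"
  shows "compact (closure {x. \<phi> x \<noteq> 0})"
proof -
  have "{x. \<phi> x \<noteq> 0} \<subseteq> cball 0 R" using assms by force
  then have "bounded {x. \<phi> x \<noteq> 0}" by (meson bounded_cball bounded_subset)
  then show ?thesis by (simp add: compact_closure)
qed

text \<open>
  This confines the support of the gradient of a test function to the support of the function.
\<close>

lemma GDERIV_zero_outside:
  assumes "GDERIV \<phi> x :> D" "open U" "x \<in> U" "\<And>y. y \<in> U \<Longrightarrow> \<phi> y = 0"
  shows "D = 0"
proof -
  have "(\<phi> has_derivative (\<lambda>h. 0)) (at x)"
    by (rule has_derivative_transform_within_open[of "\<lambda>y. 0", OF _ assms(2,3)]) (use assms(4) in auto)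
  then have "(\<lambda>h. 0) = (\<lambda>h. h \<bullet> D)"
    using assms(1) has_derivative_unique unfolding gderiv_def by blast
  then have "D \<bullet> D = 0" by metis
  then show ?thesis by simp
qed

lemma test_function_bounded_support:
  assumes "test_function \<phi> \<phi>'"
  obtains R where "R > 0" "\<And>x. norm x \<ge> R \<Longrightarrow> \<phi> x = 0" "\<And>x. norm x \<ge> R \<Longrightarrow> \<phi>' x = 0"
proof -
  have "bounded {x. \<phi> x \<noteq> 0}"
    using assms unfolding test_function_def by (meson bounded_subset closure_subset compact_imp_bounded)
  then obtain R where R: "R > 0" "\<And>x. \<phi> x \<noteq> 0 \<Longrightarrow> norm x \<le> R"
    unfolding bounded_pos by auto
  have z: "\<phi> x = 0" if "norm x > R" for x using R(2)[of x] that by fastforce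
  have "\<phi>' x = 0" if "norm x > R" for x
  proof (rule GDERIV_zero_outside[of \<phi> x _ "- cball 0 R"])
    show "GDERIV \<phi> x :> \<phi>' x" using assms unfolding test_function_def by blast
    show "\<phi> y = 0" if "y \<in> - cball 0 R" for y using z that by auto
  qed (use that in auto)
  then show ?thesis using that[of "R+1"] z R(1) by fastforce
qed

lemma test_function_bounded:
  assumes "test_function \<phi> \<phi>'"
  obtains B where "B > 0" "\<And>x. \<bar>\<phi> x\<bar> \<le> B" "\<And>x. norm (\<phi>' x) \<le> B"
proof -
  obtain R where R: "R > 0" "\<And>x. norm x \<ge> R \<Longrightarrow> \<phi> x = 0" "\<And>x. norm x \<ge> R \<Longrightarrow> \<phi>' x = 0"
    using test_function_bounded_support[OF assms] by metis
  have "compact (\<phi> ` cball 0 R)" "compact (\<phi>' ` cball 0 R)"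
    using test_function_continuous[OF assms] by (meson compact_cball compact_continuous_image continuous_on_subset subset_UNIV)+
  then have "bounded (\<phi> ` cball 0 R)" "bounded (\<phi>' ` cball 0 R)"
    using compact_imp_bounded by blast+
  then obtain B1 B2 where B: "B1 > 0" "\<And>x. x \<in> cball 0 R \<Longrightarrow> norm (\<phi> x) \<le> B1"
      "B2 > 0" "\<And>x. x \<in> cball 0 R \<Longrightarrow> norm (\<phi>' x) \<le> B2"
    unfolding bounded_pos by blast
  show ?thesis
  proof (rule that[of "max B1 B2"])
    show "\<bar>\<phi> x\<bar> \<le> max B1 B2" for x
      using B(1) B(2)[of x] R(2)[of x] by (cases "norm x \<le> R") auto
    show "norm (\<phi>' x) \<le> max B1 B2" for x
      using B(3) B(4)[of x] R(3)[of x] by (cases "norm x \<le> R") auto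
  qed (use B in auto)
qed

text \<open>
  A cutoff that is only \<open>C\<^sup>1\<close>, but explicit: the squared positive part avoids any smooth partition
  of unity, and the bound \<open>|\<nabla>(bump R)| \<le> 4 |x| / R\<^sup>2\<close> makes the cutoff errors vanish as \<open>R \<rightarrow> \<infinity>\<close>.
\<close>

definition bump :: "real \<Rightarrow> 'a::euclidean_space \<Rightarrow> real"
  where "bump R x = (max 0 (1 - (norm x)\<^sup>2 / R\<^sup>2))\<^sup>2"

definition bump_grad :: "real \<Rightarrow> 'a::euclidean_space \<Rightarrow> 'a"
  where "bump_grad R x = (- 4 * max 0 (1 - (norm x)\<^sup>2 / R\<^sup>2) / R\<^sup>2) *\<^sub>R x"

lemma DERIV_max0_squared: "((\<lambda>s::real. (max 0 s)\<^sup>2) has_real_derivative 2 * max 0 s) (at s)"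
proof (cases s "0::real" rule: linorder_cases)
  case less
  have "((\<lambda>s::real. (max 0 s)\<^sup>2) has_real_derivative 0) (at s)"
    by (rule has_field_derivative_transform_within_open[of "\<lambda>s. 0" _ s "{..<0}"])
      (use less in \<open>simp_all add: max_def\<close>)
  then show ?thesis using less by simp
next
  case greater
  have "((\<lambda>s::real. s\<^sup>2) has_real_derivative 2 * s) (at s)"
    by (auto intro!: derivative_eq_intros)
  then have "((\<lambda>s::real. (max 0 s)\<^sup>2) has_real_derivative 2 * s) (at s)"
    by (rule has_field_derivative_transform_within_open[of _ _ s "{0<..}"])
      (use greater in \<open>simp_all add: max_def\<close>)
  then show ?thesis using greater by simp
next
  case equal
  have "(\<lambda>h::real. (max 0 h)\<^sup>2 / h) \<midarrow>0\<rightarrow> 0"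
  proof (rule Lim_null_comparison)
    have "norm ((max 0 h)\<^sup>2 / h) \<le> \<bar>h\<bar>" for h :: real
      by (cases "h \<le> 0") (simp_all add: max_def power2_eq_square)
    then show "\<forall>\<^sub>F h in at 0. norm ((max 0 h)\<^sup>2 / h) \<le> \<bar>h::real\<bar>"
      by (rule always_eventually[OF allI])
    show "(\<lambda>h::real. \<bar>h\<bar>) \<midarrow>0\<rightarrow> 0" by (rule tendsto_rabs_zero[OF tendsto_ident_at])
  qed
  then show ?thesis using equal by (simp add: DERIV_def)
qed

lemma GDERIV_norm_squared: "GDERIV (\<lambda>x. (norm x)\<^sup>2) x :> 2 *\<^sub>R x"
  unfolding gderiv_def power2_norm_eq_inner
  by (auto intro!: derivative_eq_intros simp: inner_commute)

lemma GDERIV_bump: "GDERIV (bump R) x :> bump_grad R x"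
proof -
  have 1: "GDERIV (\<lambda>x. 1 - (norm x)\<^sup>2 / R\<^sup>2) x :> - (1 / R\<^sup>2) *\<^sub>R (2 *\<^sub>R x)"
    by (rule GDERIV_DERIV_compose[of "\<lambda>x. (norm x)\<^sup>2" x _ "\<lambda>r. 1 - r / R\<^sup>2", OF GDERIV_norm_squared],
        rule DERIV_cong[OF DERIV_diff[OF DERIV_const DERIV_cdivide[OF DERIV_ident]]]) simp
  from GDERIV_DERIV_compose[OF this DERIV_max0_squared]
  have "GDERIV (\<lambda>x. (max 0 (1 - (norm x)\<^sup>2 / R\<^sup>2))\<^sup>2) x :> bump_grad R x"
  proof (rule GDERIV_subst)
    have "2 * m * (- (1 / R\<^sup>2) * 2) = - 4 * m / R\<^sup>2" for m :: real by simp
    then show "(2 * max 0 (1 - (norm x)\<^sup>2 / R\<^sup>2)) *\<^sub>R - (1 / R\<^sup>2) *\<^sub>R 2 *\<^sub>R x = bump_grad R x"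
      by (simp only: bump_grad_def scaleR_scaleR)
  qed
  then show ?thesis unfolding bump_def[abs_def] .
qed

lemma bump_range: "0 \<le> bump R x" "bump R x \<le> 1"
proof -
  have "max 0 (1 - (norm x)\<^sup>2 / R\<^sup>2) \<le> 1" by simp
  then show "bump R x \<le> 1" unfolding bump_def by (intro power_le_one) simp_all
qed (simp add: bump_def)

lemma bump_outside:
  assumes "R > 0" "norm x \<ge> R" shows "bump R x = 0" "bump_grad R x = 0"
proof -
  have "(norm x)\<^sup>2 / R\<^sup>2 \<ge> 1" using assms by (simp add: power_mono)
  then show "bump R x = 0" "bump_grad R x = 0" by (auto simp: bump_def bump_grad_def)
qed

lemma bump_pos:
  assumes "norm x < R" shows "bump R x > 0"
proof -
  have "R > 0" using assms norm_ge_zero[of x] by linarith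
  then have "(norm x)\<^sup>2 / R\<^sup>2 < 1" using assms by (simp add: power_strict_mono)
  then have "max 0 (1 - (norm x)\<^sup>2 / R\<^sup>2) > 0" by linarith
  then show ?thesis unfolding bump_def by (rule zero_less_power)
qed

lemma continuous_bump: "continuous_on S (bump R)" "continuous_on S (bump_grad R)"
proof -
  show "continuous_on S (bump R)"
    using GDERIV_continuous_on[of "bump R", OF GDERIV_bump] continuous_on_subset by blast
  have "continuous_on S (\<lambda>x::'a. - 4 * max 0 (1 - (norm x)\<^sup>2 / R\<^sup>2) / R\<^sup>2)"
    unfolding divide_inverse by (intro continuous_intros)
  then show "continuous_on S (bump_grad R :: 'a \<Rightarrow> 'a)"
    unfolding bump_grad_def[abs_def] by (rule continuous_on_scaleR[OF _ continuous_on_id])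
qed

lemma bump_measurable [measurable]:
  "bump R \<in> borel_measurable borel" "bump_grad R \<in> borel_measurable borel"
  using continuous_bump by (blast intro: borel_measurable_continuous_onI)+

lemma norm_bump_grad:
  assumes "R > 0" shows "norm (bump_grad R x) \<le> 4 * norm x / R\<^sup>2"
proof -
  have "max 0 (1 - (norm x)\<^sup>2 / R\<^sup>2) \<le> 1" by simp
  then show ?thesis using assms
    by (auto simp: bump_grad_def abs_mult divide_right_mono mult_left_le_one_le mult_right_mono)
qed

lemma bump_tendsto: "(\<lambda>n. bump (real (Suc n)) x) \<longlonglongrightarrow> 1"
proof -
  have "(\<lambda>n. (norm x)\<^sup>2 / (real (Suc n))\<^sup>2) \<longlonglongrightarrow> 0"
    by (intro tendsto_divide_0[OF tendsto_const] filterlim_at_top_imp_at_infinity filterlim_pow_at_top)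
      (use filterlim_sequentially_Suc[of real] filterlim_real_sequentially in auto)
  then have "(\<lambda>n. (max 0 (1 - (norm x)\<^sup>2 / (real (Suc n))\<^sup>2))\<^sup>2) \<longlonglongrightarrow> (max 0 (1 - 0))\<^sup>2"
    by (intro tendsto_intros)
  then show ?thesis by (simp add: bump_def)
qed

lemma test_function_bump_mult:
  assumes "R > 0" "\<And>x. GDERIV p x :> p' x" "continuous_on UNIV p'"
  shows "test_function (\<lambda>x. p x * bump R x) (\<lambda>x. p x *\<^sub>R bump_grad R x + bump R x *\<^sub>R p' x)"
  unfolding test_function_def
proof (intro conjI allI)
  show "GDERIV (\<lambda>x. p x * bump R x) x :> p x *\<^sub>R bump_grad R x + bump R x *\<^sub>R p' x" for x
    by (rule GDERIV_mult[OF assms(2) GDERIV_bump])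
  show "continuous_on UNIV (\<lambda>x. p x *\<^sub>R bump_grad R x + bump R x *\<^sub>R p' x)"
    by (intro continuous_intros continuous_bump assms GDERIV_continuous_on[OF assms(2)])
  show "compact (closure {x. p x * bump R x \<noteq> 0})"
    by (rule compact_support_cball[of R]) (use bump_outside assms(1) in force)
qed

lemma real_polynomial_function_C1:
  fixes p :: "'a::euclidean_space \<Rightarrow> real"
  assumes "real_polynomial_function p"
  shows "\<exists>p'. (\<forall>x. GDERIV p x :> p' x) \<and> continuous_on UNIV p'"
  using assms
proof induction
  case (linear f)
  have "GDERIV f x :> (\<Sum>b\<in>Basis. f b *\<^sub>R b)" for x
  proof -
    have eq: "f h = h \<bullet> (\<Sum>b\<in>Basis. f b *\<^sub>R b)" for h
    proof -
      have "f h = f (\<Sum>b\<in>Basis. (h \<bullet> b) *\<^sub>R b)" by (simp add: euclidean_representation)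
      also have "\<dots> = (\<Sum>b\<in>Basis. (h \<bullet> b) * f b)"
        using linear by (simp add: bounded_linear.linear linear_sum linear_cmul)
      finally show ?thesis by (simp add: inner_sum_right mult.commute)
    qed
    show ?thesis
      unfolding gderiv_def eq[symmetric] by (rule bounded_linear_imp_has_derivative[OF linear])
  qed
  then show ?case by (intro exI[of _ "\<lambda>x. \<Sum>b\<in>Basis. f b *\<^sub>R b"]) simp
next
  case (const c)
  then show ?case by (intro exI[of _ "\<lambda>x. 0"]) (simp add: GDERIV_const)
next
  case (add f g)
  then obtain f' g' where "\<forall>x. GDERIV f x :> f' x" "continuous_on UNIV f'"
    "\<forall>x. GDERIV g x :> g' x" "continuous_on UNIV g'" by blast
  then show ?case by (intro exI[of _ "\<lambda>x. f' x + g' x"]) (auto intro!: GDERIV_add continuous_intros)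
next
  case (mult f g)
  then obtain f' g' where "\<forall>x. GDERIV f x :> f' x" "continuous_on UNIV f'"
    "\<forall>x. GDERIV g x :> g' x" "continuous_on UNIV g'" by blast
  then show ?case
    by (intro exI[of _ "\<lambda>x. f x *\<^sub>R g' x + g x *\<^sub>R f' x"])
      (auto intro!: GDERIV_mult continuous_intros GDERIV_continuous_on)
qed

text \<open>
  A measurable function is almost everywhere a limit of continuous functions.  On a ball these are
  uniformly close to polynomials by the Stone-Weierstrass theorem, and a polynomial times the cutoff is
  a test function.  Clamping the continuous functions first keeps the approximation bounded, as
  dominated convergence demands; multiplying by the cutoff is harmless because it is positive inside
  the ball.
\<close>

lemma bounded_approx_by_test_functions:
  fixes \<psi> :: "'a::euclidean_space \<Rightarrow> real"
  assumes [measurable]: "\<psi> \<in> borel_measurable borel" and bd: "\<And>x. \<bar>\<psi> x\<bar> \<le> 1" and R: "R > 0"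
  obtains \<phi> \<phi>' where "\<And>n. test_function (\<phi> n) (\<phi>' n)"
    "\<And>n x. \<bar>\<phi> n x\<bar> \<le> 2" "\<And>n x. norm x \<ge> R \<Longrightarrow> \<phi> n x = 0"
    "AE x in lborel. (\<lambda>n::nat. \<phi> n x) \<longlonglongrightarrow> bump R x * \<psi> x"
proof -
  have "\<psi> measurable_on UNIV"
    by (rule lebesgue_measurable_imp_measurable_on) (auto intro: measurable_completion)
  then obtain N k where N: "negligible N" and k: "\<And>n. continuous_on UNIV (k n)"
    and lim: "\<And>x. x \<notin> N \<Longrightarrow> (\<lambda>n::nat. k n x) \<longlonglongrightarrow> \<psi> x"
    unfolding measurable_on_def by auto
  define c where "c n x = max (-1) (min 1 (k n x))" for n x
  have c_cont: "continuous_on (cball 0 R) (c n)" for n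
    unfolding c_def by (intro continuous_intros continuous_on_subset[OF k]) auto
  have c_bd: "\<bar>c n x\<bar> \<le> 1" for n x by (auto simp: c_def)
  have c_lim: "(\<lambda>n. c n x) \<longlonglongrightarrow> \<psi> x" if "x \<notin> N" for x
  proof -
    have "(\<lambda>n. c n x) \<longlonglongrightarrow> max (-1) (min 1 (\<psi> x))"
      unfolding c_def by (intro tendsto_intros lim that)
    moreover have "max (-1) (min 1 (\<psi> x)) = \<psi> x" using bd[of x] by linarith
    ultimately show ?thesis by simp
  qed
  have "\<exists>p p'. (\<forall>x. GDERIV p x :> p' x) \<and> continuous_on UNIV p' \<and>
      (\<forall>x\<in>cball 0 R. \<bar>c n x - p x\<bar> < 1 / real (Suc n))" for n
  proof -
    obtain p where "real_polynomial_function p" "\<And>x. x \<in> cball 0 R \<Longrightarrow> \<bar>c n x - p x\<bar> < 1 / real (Suc n)"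
      using Stone_Weierstrass_real_polynomial_function[OF _ c_cont, of "1 / real (Suc n)" n] by auto
    then show ?thesis using real_polynomial_function_C1 by blast
  qed
  then obtain p p' where p: "\<And>n x. GDERIV (p n) x :> p' n x" "\<And>n. continuous_on UNIV (p' n)"
      "\<And>n x. x \<in> cball 0 R \<Longrightarrow> \<bar>c n x - p n x\<bar> < 1 / real (Suc n)"
    by metis
  show ?thesis
  proof (rule that[of "\<lambda>n x. p n x * bump R x" "\<lambda>n x. p n x *\<^sub>R bump_grad R x + bump R x *\<^sub>R p' n x"])
    show "test_function (\<lambda>x. p n x * bump R x) (\<lambda>x. p n x *\<^sub>R bump_grad R x + bump R x *\<^sub>R p' n x)" for n
      by (rule test_function_bump_mult) (use R p in auto)
    show zero: "p n x * bump R x = 0" if "norm x \<ge> R" for n x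
      using bump_outside[OF R that] by simp
    show "\<bar>p n x * bump R x\<bar> \<le> 2" for n x
    proof (cases "norm x \<le> R")
      case True
      have "1 / real (Suc n) \<le> 1" by simp
      then have "\<bar>p n x\<bar> \<le> 2" using p(3)[of x n] c_bd[of n x] True unfolding mem_cball_0 by linarith
      then have "\<bar>p n x\<bar> * bump R x \<le> 2 * 1"
        by (rule mult_mono) (use bump_range[of R x] in auto)
      then show ?thesis using bump_range[of R x] by (simp add: abs_mult)
    qed (use zero[of x n] in auto)
    have "(\<lambda>n. p n x * bump R x) \<longlonglongrightarrow> \<psi> x * bump R x" if "x \<notin> N" for x
    proof (cases "norm x \<le> R")
      case True
      have "(\<lambda>n. p n x - c n x) \<longlonglongrightarrow> 0"
      proof (rule Lim_null_comparison)
        show "\<forall>\<^sub>F n in sequentially. norm (p n x - c n x) \<le> 1 / real (Suc n)"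
          using p(3)[of x] True by (intro always_eventually) (auto simp: abs_minus_commute less_imp_le)
        show "(\<lambda>n. 1 / real (Suc n)) \<longlonglongrightarrow> 0" using LIMSEQ_inverse_real_of_nat by (simp add: inverse_eq_divide)
      qed
      from tendsto_add[OF this c_lim[OF that]] have "(\<lambda>n. p n x) \<longlonglongrightarrow> \<psi> x" by simp
      then show ?thesis by (intro tendsto_intros)
    qed (use bump_outside[OF R, of x] in auto)
    moreover have "AE x in lborel. x \<notin> N"
      using N AE_not_in[of N lebesgue] by (simp add: negligible_iff_null_sets AE_completion_iff)
    ultimately show "AE x in lborel. (\<lambda>n. p n x * bump R x) \<longlonglongrightarrow> bump R x * \<psi> x"
      by (auto simp: mult.commute elim!: eventually_mono)
  qed
qed

section \<open>The weak gradient of a nonnegative function vanishes where the function does\<close>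

lemma lborel_translate:
  fixes u :: "'a::euclidean_space \<Rightarrow> 'b::{banach, second_countable_topology}"
  assumes u: "integrable lborel u"
  shows "integrable lborel (\<lambda>x. u (x + h))" "(\<integral>x. u (x + h) \<partial>lborel) = (\<integral>x. u x \<partial>lborel)"
proof -
  have [measurable]: "u \<in> borel_measurable borel"
    using borel_measurable_integrable[OF u] by simp
  have "integrable (distr lborel borel ((+) h)) u"
    using u by (simp add: lborel_distr_plus)
  then show "integrable lborel (\<lambda>x. u (x + h))"
    by (subst (asm) integrable_distr_eq) (simp_all add: add.commute)
  have "(\<integral>x. u x \<partial>lborel) = (\<integral>x. u x \<partial>(distr lborel borel ((+) h)))"
    by (simp add: lborel_distr_plus)
  also have "\<dots> = (\<integral>x. u (x + h) \<partial>lborel)"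
    by (subst integral_distr) (simp_all add: add.commute)
  finally show "(\<integral>x. u (x + h) \<partial>lborel) = (\<integral>x. u x \<partial>lborel)" by simp
qed

lemma integrable_indicator_cball: "integrable lborel (indicator (cball (0::'a::euclidean_space) R) :: 'a \<Rightarrow> real)"
  by (rule integrable_real_indicator) (use emeasure_lborel_cball_finite[of 0 R] in auto)

lemma test_function_integrable:
  assumes "test_function \<phi> \<phi>'"
  shows "integrable lborel \<phi>"
proof -
  obtain R where R: "\<And>x. norm x \<ge> R \<Longrightarrow> \<phi> x = 0"
    using test_function_bounded_support[OF assms] by metis
  obtain B where B: "B > 0" "\<And>x. \<bar>\<phi> x\<bar> \<le> B"
    using test_function_bounded[OF assms] by metis
  show ?thesis
  proof (rule Bochner_Integration.integrable_bound)
    show "integrable lborel (\<lambda>x. B * indicator (cball 0 R) x)"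
      by (intro integrable_mult_right integrable_indicator_cball)
    show "\<phi> \<in> borel_measurable lborel" using test_function_continuous[OF assms] by simp
    show "AE x in lborel. norm (\<phi> x) \<le> norm (B * indicator (cball 0 R) x)"
    proof (rule AE_I2)
      fix x show "norm (\<phi> x) \<le> norm (B * indicator (cball 0 R) x)"
        using B R[of x] by (cases "norm x \<le> R") (auto simp: abs_mult)
    qed
  qed
qed

text \<open>
  Clamping \<open>u\<close> to \<open>[-n, n]\<close> and cutting off at radius \<open>n\<close> changes it little in \<open>L\<^sup>1\<close>, and what results
  is a multiple of a bounded function to which the approximation by bounded test functions applies.
\<close>

lemma L1_approx_by_test_function:
  fixes u :: "'a::euclidean_space \<Rightarrow> real"
  assumes u: "integrable lborel u" and "\<epsilon> > 0"
  obtains \<phi> \<phi>' where "test_function \<phi> \<phi>'" "(\<integral>x. \<bar>u x - \<phi> x\<bar> \<partial>lborel) < \<epsilon>"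
proof -
  have [measurable]: "u \<in> borel_measurable borel"
    using borel_measurable_integrable[OF u] by simp
  define c where "c n x = max (-1) (min 1 (u x / real (Suc n)))" for n x
  have c_meas [measurable]: "c n \<in> borel_measurable borel" for n unfolding c_def[abs_def] by measurable
  have c_bd: "\<bar>c n x\<bar> \<le> 1" for n x by (auto simp: c_def)
  have c_le: "real (Suc n) * \<bar>c n x\<bar> \<le> \<bar>u x\<bar>" for n x
  proof -
    have "\<bar>c n x\<bar> \<le> \<bar>u x / real (Suc n)\<bar>" unfolding c_def by linarith
    then show ?thesis by (simp add: field_simps)
  qed
  define v where "v n x = real (Suc n) * (bump (real (Suc n)) x * c n x)" for n x
  have [measurable]: "v n \<in> borel_measurable borel" for n unfolding v_def[abs_def] by measurable
  have v_bd: "\<bar>v n x\<bar> \<le> \<bar>u x\<bar>" for n x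
  proof -
    have "\<bar>v n x\<bar> = bump (real (Suc n)) x * (real (Suc n) * \<bar>c n x\<bar>)"
      using bump_range[of "real (Suc n)" x] by (simp add: v_def abs_mult)
    also have "\<dots> \<le> 1 * \<bar>u x\<bar>"
      by (rule mult_mono) (use bump_range c_le in auto)
    finally show ?thesis by simp
  qed
  have v_lim: "(\<lambda>n. v n x) \<longlonglongrightarrow> u x" for x
  proof -
    obtain n0 where n0: "real n0 \<ge> \<bar>u x\<bar>" using real_arch_simple by blast
    have "bump (real (Suc n)) x * u x = v n x" if "n \<ge> n0" for n
    proof -
      have "\<bar>u x / real (Suc n)\<bar> \<le> 1" using n0 that by (simp add: divide_le_eq)
      then have "c n x = u x / real (Suc n)" unfolding c_def by linarith
      then show ?thesis by (simp add: v_def)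
    qed
    then have "\<forall>\<^sub>F n in sequentially. bump (real (Suc n)) x * u x = v n x"
      by (auto simp: eventually_sequentially)
    moreover have "(\<lambda>n. bump (real (Suc n)) x * u x) \<longlonglongrightarrow> 1 * u x"
      by (intro tendsto_intros bump_tendsto)
    ultimately show ?thesis using tendsto_cong by fastforce
  qed
  have "(\<lambda>n. \<integral>x. \<bar>u x - v n x\<bar> \<partial>lborel) \<longlonglongrightarrow> (\<integral>x. 0 \<partial>(lborel::'a measure))"
  proof (rule integral_dominated_convergence[where w = "\<lambda>x. 2 * \<bar>u x\<bar>"])
    show "AE x in lborel. (\<lambda>n. \<bar>u x - v n x\<bar>) \<longlonglongrightarrow> 0"
    proof (rule AE_I2)
      show "(\<lambda>n. \<bar>u x - v n x\<bar>) \<longlonglongrightarrow> 0" for x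
        using tendsto_rabs[OF tendsto_diff[OF tendsto_const[of "u x"] v_lim[of x]]] by simp
    qed
    show "AE x in lborel. norm \<bar>u x - v n x\<bar> \<le> 2 * \<bar>u x\<bar>" for n
      by (rule AE_I2) (use v_bd[of n] in \<open>smt (verit) real_norm_def\<close>)
    show "integrable lborel (\<lambda>x. 2 * \<bar>u x\<bar>)" using u by simp
  qed auto
  then have "(\<lambda>n. \<integral>x. \<bar>u x - v n x\<bar> \<partial>lborel) \<longlonglongrightarrow> 0" by simp
  then have "\<forall>\<^sub>F n in sequentially. (\<integral>x. \<bar>u x - v n x\<bar> \<partial>lborel) < \<epsilon> / 2"
    using \<open>\<epsilon> > 0\<close> by (auto dest: order_tendstoD(2)[where a="\<epsilon>/2"])
  then obtain n where n: "(\<integral>x. \<bar>u x - v n x\<bar> \<partial>lborel) < \<epsilon> / 2"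
    by (auto simp: eventually_sequentially)
  define N where "N = real (Suc n)"
  have "N > 0" by (simp add: N_def)
  obtain \<phi> \<phi>' where \<phi>: "\<And>k. test_function (\<phi> k) (\<phi>' k)"
    "\<And>k x. \<bar>\<phi> k x\<bar> \<le> 2" "\<And>k x. norm x \<ge> N \<Longrightarrow> \<phi> k x = 0"
    "AE x in lborel. (\<lambda>k::nat. \<phi> k x) \<longlonglongrightarrow> bump N x * c n x"
    by (rule bounded_approx_by_test_functions[OF c_meas[of n] c_bd[of n] \<open>N > 0\<close>])
      (rule that, assumption+)
  have [measurable]: "\<phi> k \<in> borel_measurable borel" for k
    using test_function_continuous[OF \<phi>(1)] by simp
  have int_v: "integrable lborel (v n)"
    by (rule Bochner_Integration.integrable_bound[OF u]) (use v_bd in auto)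
  have "(\<lambda>k. \<integral>x. \<bar>v n x - N * \<phi> k x\<bar> \<partial>lborel) \<longlonglongrightarrow> (\<integral>x. 0 \<partial>(lborel::'a measure))"
  proof (rule integral_dominated_convergence[where w = "\<lambda>x. \<bar>v n x\<bar> + N * (2 * indicator (cball 0 N) x)"])
    show "AE x in lborel. (\<lambda>k. \<bar>v n x - N * \<phi> k x\<bar>) \<longlonglongrightarrow> 0"
      using \<phi>(4)
    proof eventually_elim
      case (elim x)
      have "(\<lambda>k. \<bar>v n x - N * \<phi> k x\<bar>) \<longlonglongrightarrow> \<bar>v n x - N * (bump N x * c n x)\<bar>"
        by (intro tendsto_intros elim)
      then show ?case by (simp add: v_def N_def)
    qed
    show "AE x in lborel. norm \<bar>v n x - N * \<phi> k x\<bar> \<le> \<bar>v n x\<bar> + N * (2 * indicator (cball 0 N) x)" for k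
    proof (rule AE_I2)
      fix x
      have "\<bar>\<phi> k x\<bar> \<le> 2 * indicator (cball 0 N) x"
        using \<phi>(2)[of k x] \<phi>(3)[of x k] by (cases "norm x \<le> N") auto
      then have "\<bar>N * \<phi> k x\<bar> \<le> N * (2 * indicator (cball 0 N) x)"
        using \<open>N > 0\<close> unfolding abs_mult by (intro mult_mono) auto
      then show "norm \<bar>v n x - N * \<phi> k x\<bar> \<le> \<bar>v n x\<bar> + N * (2 * indicator (cball 0 N) x)"
        unfolding real_norm_def by linarith
    qed
    show "integrable lborel (\<lambda>x. \<bar>v n x\<bar> + N * (2 * indicator (cball 0 N) x))"
      by (intro Bochner_Integration.integrable_add integrable_abs int_v integrable_mult_right integrable_indicator_cball)
  qed auto
  then have "(\<lambda>k. \<integral>x. \<bar>v n x - N * \<phi> k x\<bar> \<partial>lborel) \<longlonglongrightarrow> 0" by simp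
  then have "\<forall>\<^sub>F k in sequentially. (\<integral>x. \<bar>v n x - N * \<phi> k x\<bar> \<partial>lborel) < \<epsilon> / 2"
    using \<open>\<epsilon> > 0\<close> by (auto dest: order_tendstoD(2)[where a="\<epsilon>/2"])
  then obtain k where k: "(\<integral>x. \<bar>v n x - N * \<phi> k x\<bar> \<partial>lborel) < \<epsilon> / 2"
    by (auto simp: eventually_sequentially)
  have int_\<phi>: "integrable lborel (\<lambda>x. N * \<phi> k x)"
    using test_function_integrable[OF \<phi>(1)] by simp
  have "(\<integral>x. \<bar>u x - N * \<phi> k x\<bar> \<partial>lborel) \<le> (\<integral>x. \<bar>u x - v n x\<bar> + \<bar>v n x - N * \<phi> k x\<bar> \<partial>lborel)"
    by (rule integral_mono) (use u int_v int_\<phi> in auto)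
  also have "\<dots> = (\<integral>x. \<bar>u x - v n x\<bar> \<partial>lborel) + (\<integral>x. \<bar>v n x - N * \<phi> k x\<bar> \<partial>lborel)"
    using u int_v int_\<phi> by (intro Bochner_Integration.integral_add) auto
  finally have "(\<integral>x. \<bar>u x - N * \<phi> k x\<bar> \<partial>lborel) < \<epsilon>" using n k by linarith
  moreover have "test_function (\<lambda>x. N * \<phi> k x) (\<lambda>x. N *\<^sub>R \<phi>' k x)"
  proof -
    have "GDERIV (\<lambda>x. N * \<phi> k x) x :> N *\<^sub>R \<phi>' k x" for x
      using GDERIV_mult[OF GDERIV_const, of "\<phi> k" x "\<phi>' k x" N] \<phi>(1)[of k]
      unfolding test_function_def by simp
    moreover have "continuous_on UNIV (\<lambda>x. N *\<^sub>R \<phi>' k x)"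
      by (intro continuous_intros test_function_continuous(2)[OF \<phi>(1)])
    moreover have "compact (closure {x. N * \<phi> k x \<noteq> 0})"
      by (rule compact_support_cball[of N]) (use \<phi>(3) in auto)
    ultimately show ?thesis unfolding test_function_def by blast
  qed
  ultimately show ?thesis using that by blast
qed

lemma test_function_directional_derivative:
  assumes "test_function \<phi> \<phi>'"
  shows "((\<lambda>s. \<phi> (x - s *\<^sub>R e)) has_real_derivative - (\<phi>' (x - s *\<^sub>R e) \<bullet> e)) (at s)"
proof -
  have "(\<phi> has_derivative (\<lambda>h. h \<bullet> \<phi>' (x - s *\<^sub>R e))) (at (x - s *\<^sub>R e))"
    using assms unfolding test_function_def gderiv_def by blast
  moreover have "((\<lambda>s. x - s *\<^sub>R e) has_derivative (\<lambda>h. - (h *\<^sub>R e))) (at s)"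
    by (auto intro!: derivative_eq_intros)
  ultimately have "((\<lambda>s. \<phi> (x - s *\<^sub>R e)) has_derivative (\<lambda>h. - (h *\<^sub>R e) \<bullet> \<phi>' (x - s *\<^sub>R e))) (at s)"
    using has_derivative_compose by blast
  moreover have "(\<lambda>h. - (h *\<^sub>R e) \<bullet> \<phi>' (x - s *\<^sub>R e)) = (*) (- (\<phi>' (x - s *\<^sub>R e) \<bullet> e))"
    by (auto simp: inner_commute)
  ultimately show ?thesis unfolding has_field_derivative_def by simp
qed

lemma test_function_lipschitz:
  assumes "test_function \<phi> \<phi>'" "\<And>x. norm (\<phi>' x) \<le> B"
  shows "\<bar>\<phi> (x - t *\<^sub>R e) - \<phi> (x - s *\<^sub>R e)\<bar> \<le> B * norm e * \<bar>t - s\<bar>"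
proof -
  have *: "\<bar>\<phi>' y \<bullet> e\<bar> \<le> B * norm e" for y
    using Cauchy_Schwarz_ineq2[of "\<phi>' y" e] assms(2)[of y]
    by (meson mult_right_mono norm_ge_zero order_trans)
  show ?thesis
    using field_differentiable_bound[of UNIV "\<lambda>s. \<phi> (x - s *\<^sub>R e)" "\<lambda>s. - (\<phi>' (x - s *\<^sub>R e) \<bullet> e)" "B * norm e" s t]
      test_function_directional_derivative[OF assms(1)] * by (simp add: abs_minus_commute)
qed

lemma test_function_translate:
  assumes "test_function \<phi> \<phi>'"
  shows "test_function (\<lambda>x. \<phi> (x - c)) (\<lambda>x. \<phi>' (x - c))"
  unfolding test_function_def
proof (intro conjI allI)
  have cont: "continuous_on UNIV (\<lambda>x. x - c)" by (intro continuous_intros)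
  show "continuous_on UNIV (\<lambda>x. \<phi>' (x - c))"
    by (rule continuous_on_compose2[OF test_function_continuous(2)[OF assms] cont]) auto
  show "GDERIV (\<lambda>x. \<phi> (x - c)) x :> \<phi>' (x - c)" for x
  proof -
    have "(\<phi> has_derivative (\<lambda>h. h \<bullet> \<phi>' (x - c))) (at (x - c))"
      using assms unfolding test_function_def gderiv_def by blast
    moreover have "((\<lambda>x. x - c) has_derivative (\<lambda>h. h)) (at x)"
      by (auto intro!: derivative_eq_intros)
    ultimately show ?thesis
      using has_derivative_compose unfolding gderiv_def by blast
  qed
  obtain R where R: "\<And>x. norm x \<ge> R \<Longrightarrow> \<phi> x = 0"
    using test_function_bounded_support[OF assms] by metis
  show "compact (closure {x. \<phi> (x - c) \<noteq> 0})"
  proof (rule compact_support_cball[of "R + norm c"])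
    show "\<phi> (x - c) = 0" if "norm x > R + norm c" for x
      using that norm_triangle_ineq2[of x c] by (intro R) linarith
  qed
qed

text \<open>
  Clear for test functions, which are Lipschitz with bounded support; translations preserve the \<open>L\<^sup>1\<close>
  norm, so the property passes to \<open>L\<^sup>1\<close> limits.
\<close>

lemma L1_translation_continuous:
  fixes u :: "'a::euclidean_space \<Rightarrow> real"
  assumes u: "integrable lborel u" and "\<epsilon> > 0"
  obtains \<delta> where "\<delta> > 0" "\<And>s. \<bar>s\<bar> \<le> \<delta> \<Longrightarrow> (\<integral>x. \<bar>u (x + s *\<^sub>R e) - u x\<bar> \<partial>lborel) < \<epsilon>"
proof -
  obtain \<phi> \<phi>' where \<phi>: "test_function \<phi> \<phi>'" "(\<integral>x. \<bar>u x - \<phi> x\<bar> \<partial>lborel) < \<epsilon> / 3"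
    using L1_approx_by_test_function[OF u, of "\<epsilon> / 3"] \<open>\<epsilon> > 0\<close> by auto
  obtain R where R: "R > 0" "\<And>x. norm x \<ge> R \<Longrightarrow> \<phi> x = 0"
    using test_function_bounded_support[OF \<phi>(1)] by metis
  obtain B where B: "B > 0" "\<And>x. norm (\<phi>' x) \<le> B"
    using test_function_bounded[OF \<phi>(1)] by metis
  define R' where "R' = R + norm e"
  define V where "V = (\<integral>x. indicator (cball 0 R') x \<partial>(lborel :: 'a measure)) * (B * norm e)"
  have "V \<ge> 0" unfolding V_def using B by (intro mult_nonneg_nonneg integral_nonneg_AE) auto
  define \<delta> where "\<delta> = min 1 (\<epsilon> / (3 * (V + 1)))"
  have "\<delta> > 0" using \<open>V \<ge> 0\<close> \<open>\<epsilon> > 0\<close> by (simp add: \<delta>_def)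
  have int_\<phi>: "integrable lborel \<phi>" by (rule test_function_integrable[OF \<phi>(1)])
  have "(\<integral>x. \<bar>u (x + s *\<^sub>R e) - u x\<bar> \<partial>lborel) < \<epsilon>" if s: "\<bar>s\<bar> \<le> \<delta>" for s
  proof -
    have iu: "integrable lborel (\<lambda>x. u (x + s *\<^sub>R e))" and i\<phi>: "integrable lborel (\<lambda>x. \<phi> (x + s *\<^sub>R e))"
      using lborel_translate(1) u int_\<phi> by blast+
    have 1: "(\<integral>x. \<bar>u (x + s *\<^sub>R e) - \<phi> (x + s *\<^sub>R e)\<bar> \<partial>lborel) < \<epsilon> / 3"
      using lborel_translate(2)[of "\<lambda>x. \<bar>u x - \<phi> x\<bar>" "s *\<^sub>R e"] u int_\<phi> \<phi>(2) by auto
    have s1: "\<bar>s\<bar> \<le> 1" using s by (simp add: \<delta>_def)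
    have pt: "\<bar>\<phi> (x + s *\<^sub>R e) - \<phi> x\<bar> \<le> indicator (cball 0 R') x * (B * norm e) * \<bar>s\<bar>" for x
    proof (cases "norm x \<le> R'")
      case True
      then show ?thesis
        using test_function_lipschitz[OF \<phi>(1) B(2), of x "- s" e 0] by simp
    next
      case False
      have "norm (s *\<^sub>R e) \<le> norm e" using s1 by (simp add: mult_left_le_one_le)
      moreover have "R + norm e < norm x" using False unfolding R'_def by simp
      ultimately have "norm (x + s *\<^sub>R e) \<ge> R" "norm x \<ge> R"
        using norm_triangle_ineq4[of "x + s *\<^sub>R e" "s *\<^sub>R e"] norm_ge_zero[of e]
        unfolding add_diff_cancel_right' by linarith+
      then show ?thesis using R(2) False by simp
    qed
    have "(\<integral>x. \<bar>\<phi> (x + s *\<^sub>R e) - \<phi> x\<bar> \<partial>lborel)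
        \<le> (\<integral>x. indicator (cball 0 R') x * (B * norm e) * \<bar>s\<bar> \<partial>(lborel :: 'a measure))"
    proof (rule integral_mono)
      show "integrable lborel (\<lambda>x::'a. indicator (cball 0 R') x * (B * norm e) * \<bar>s\<bar>)"
        by (intro integrable_mult_left integrable_indicator_cball)
    qed (use i\<phi> int_\<phi> pt in auto)
    also have "\<dots> = V * \<bar>s\<bar>" by (simp add: V_def)
    also have "\<dots> \<le> V * (\<epsilon> / (3 * (V + 1)))"
      using s \<open>V \<ge> 0\<close> by (intro mult_left_mono) (auto simp: \<delta>_def)
    also have "\<dots> \<le> \<epsilon> / 3" using \<open>V \<ge> 0\<close> \<open>\<epsilon> > 0\<close> by (simp add: field_simps)
    finally have 2: "(\<integral>x. \<bar>\<phi> (x + s *\<^sub>R e) - \<phi> x\<bar> \<partial>lborel) \<le> \<epsilon> / 3" .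
    have "(\<integral>x. \<bar>u (x + s *\<^sub>R e) - u x\<bar> \<partial>lborel)
      \<le> (\<integral>x. \<bar>u (x + s *\<^sub>R e) - \<phi> (x + s *\<^sub>R e)\<bar> + \<bar>\<phi> (x + s *\<^sub>R e) - \<phi> x\<bar> + \<bar>u x - \<phi> x\<bar> \<partial>lborel)"
      by (rule integral_mono) (use u iu i\<phi> int_\<phi> in auto)
    also have "\<dots> = (\<integral>x. \<bar>u (x + s *\<^sub>R e) - \<phi> (x + s *\<^sub>R e)\<bar> \<partial>lborel)
        + (\<integral>x. \<bar>\<phi> (x + s *\<^sub>R e) - \<phi> x\<bar> \<partial>lborel) + (\<integral>x. \<bar>u x - \<phi> x\<bar> \<partial>lborel)"
      using u iu i\<phi> int_\<phi> by simp
    finally show ?thesis using 1 2 \<phi>(2) by linarith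
  qed
  then show ?thesis using that \<open>\<delta> > 0\<close> by blast
qed

lemma locally_integrable_mult:
  fixes u :: "'a::euclidean_space \<Rightarrow> real" and b :: "'a \<Rightarrow> 'b::{banach, second_countable_topology}"
  assumes u: "\<And>K. compact K \<Longrightarrow> set_integrable lborel K u" "u \<in> borel_measurable borel"
    and b: "b \<in> borel_measurable borel" "\<And>x. norm (b x) \<le> B" "\<And>x. norm x > R \<Longrightarrow> b x = 0"
  shows "integrable lborel (\<lambda>x. u x *\<^sub>R b x)"
proof (rule Bochner_Integration.integrable_bound)
  show "integrable lborel (\<lambda>x. B * (indicator (cball 0 R) x *\<^sub>R u x))"
    using u(1)[of "cball 0 R"] unfolding set_integrable_def by (intro integrable_mult_right) simp
  show "(\<lambda>x. u x *\<^sub>R b x) \<in> borel_measurable lborel" using u b by simp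
  show "AE x in lborel. norm (u x *\<^sub>R b x) \<le> norm (B * (indicator (cball 0 R) x *\<^sub>R u x))"
  proof (rule AE_I2)
    fix x
    have "B \<ge> 0" using b(2)[of x] norm_ge_zero order_trans by blast
    then show "norm (u x *\<^sub>R b x) \<le> norm (B * (indicator (cball 0 R) x *\<^sub>R u x))"
      using b(2,3)[of x] by (cases "norm x \<le> R") (auto simp: abs_mult mult.commute[of B] intro: mult_left_mono)
  qed
qed

lemma weak_gradient_locally_integrable:
  assumes "has_weak_gradient f g"
  shows "compact K \<Longrightarrow> set_integrable lborel K f" "f \<in> borel_measurable borel"
    and "compact K \<Longrightarrow> set_integrable lborel K (\<lambda>x. g x \<bullet> e)" "(\<lambda>x. g x \<bullet> e) \<in> borel_measurable borel"
proof -
  have m: "g \<in> borel_measurable borel" "f \<in> borel_measurable borel"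
    using assms unfolding has_weak_gradient_def by blast+
  then show "f \<in> borel_measurable borel" "(\<lambda>x. g x \<bullet> e) \<in> borel_measurable borel" by simp_all
  assume K: "compact K"
  then have "set_integrable lborel K g" "set_integrable lborel K f"
    using assms unfolding has_weak_gradient_def by blast+
  then show "set_integrable lborel K f" "set_integrable lborel K (\<lambda>x. g x \<bullet> e)"
    unfolding set_integrable_def
    using integrable_inner_left[of e lborel "\<lambda>x. indicator K x *\<^sub>R g x"] by auto
qed

lemma weak_gradient_mult_integrable:
  fixes b :: "'a::euclidean_space \<Rightarrow> real"
  assumes "has_weak_gradient f g"
    and b: "b \<in> borel_measurable borel" "\<And>x. \<bar>b x\<bar> \<le> B" "\<And>x. norm x > R \<Longrightarrow> b x = 0"
  shows "integrable lborel (\<lambda>x. f x * b x)" "integrable lborel (\<lambda>x. b x * (g x \<bullet> e))"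
proof -
  note w = weak_gradient_locally_integrable[OF assms(1)]
  have b': "norm (b x) \<le> B" for x using b(2) by simp
  show "integrable lborel (\<lambda>x. f x * b x)"
    using locally_integrable_mult[OF w(1,2) b(1) b' b(3)] by simp
  show "integrable lborel (\<lambda>x. b x * (g x \<bullet> e))"
    using locally_integrable_mult[OF w(3,4) b(1) b' b(3)] by (simp add: mult.commute)
qed

lemma weak_gradient_test_directional:
  assumes w: "has_weak_gradient f g" and t: "test_function \<phi> \<phi>'"
  shows "(\<integral>x. f x * (\<phi>' x \<bullet> e) \<partial>lborel) = - (\<integral>x. \<phi> x * (g x \<bullet> e) \<partial>lborel)"
proof -
  obtain R where R: "\<And>x. norm x \<ge> R \<Longrightarrow> \<phi> x = 0" "\<And>x. norm x \<ge> R \<Longrightarrow> \<phi>' x = 0"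
    using test_function_bounded_support[OF t] by metis
  obtain B where B: "B > 0" "\<And>x. \<bar>\<phi> x\<bar> \<le> B" "\<And>x. norm (\<phi>' x) \<le> B"
    using test_function_bounded[OF t] by metis
  note m = test_function_continuous(3,4)[OF t]
  have i1: "integrable lborel (\<lambda>x. f x *\<^sub>R \<phi>' x)"
    using weak_gradient_locally_integrable(1,2)[OF w] m(2) B(3)
    by (rule locally_integrable_mult[where R = R]) (use R in auto)
  have gi: "integrable lborel (\<lambda>x. \<phi> x *\<^sub>R g x)"
  proof (rule Bochner_Integration.integrable_bound)
    have [measurable]: "g \<in> borel_measurable borel" using w unfolding has_weak_gradient_def by blast
    show "(\<lambda>x. \<phi> x *\<^sub>R g x) \<in> borel_measurable lborel" using m by simp
    show "integrable lborel (\<lambda>x. B * norm (indicator (cball 0 R) x *\<^sub>R g x))"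
      using w unfolding has_weak_gradient_def set_integrable_def by (intro integrable_mult_right integrable_norm) auto
    show "AE x in lborel. norm (\<phi> x *\<^sub>R g x) \<le> norm (B * norm (indicator (cball 0 R) x *\<^sub>R g x))"
    proof (rule AE_I2)
      show "norm (\<phi> x *\<^sub>R g x) \<le> norm (B * norm (indicator (cball 0 R) x *\<^sub>R g x))" for x
        using B R(1)[of x] by (cases "norm x \<le> R") (auto simp: abs_mult intro: mult_right_mono)
    qed
  qed
  have "(\<integral>x. f x * (\<phi>' x \<bullet> e) \<partial>lborel) = (\<integral>x. f x *\<^sub>R \<phi>' x \<partial>lborel) \<bullet> e"
    using i1 by (subst integral_inner_left[symmetric]) auto
  also have "\<dots> = - ((\<integral>x. \<phi> x *\<^sub>R g x \<partial>lborel) \<bullet> e)"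
    using weak_gradient_test[OF w t] by simp
  also have "(\<integral>x. \<phi> x *\<^sub>R g x \<partial>lborel) \<bullet> e = (\<integral>x. \<phi> x * (g x \<bullet> e) \<partial>lborel)"
    using gi by (subst integral_inner_left[symmetric]) auto
  finally show ?thesis .
qed

text \<open>
  Differentiation under the integral moves the derivative to the test function, and the weak gradient
  takes it back to \<open>f\<close>.  In this form the mean value theorem applies to the pairing of a function that
  is only weakly differentiable.
\<close>

lemma DERIV_translated_pairing:
  fixes f :: "'a::euclidean_space \<Rightarrow> real"
  assumes w: "has_weak_gradient f g" and t: "test_function \<phi> \<phi>'"
  shows "((\<lambda>s. \<integral>x. f x * \<phi> (x - s *\<^sub>R e) \<partial>lborel) has_real_derivative
    (\<integral>x. \<phi> (x - s *\<^sub>R e) * (g x \<bullet> e) \<partial>lborel)) (at s)"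
proof -
  obtain R where R: "\<And>x. norm x \<ge> R \<Longrightarrow> \<phi> x = 0"
    using test_function_bounded_support[OF t] by metis
  obtain B where B: "B > 0" "\<And>x. \<bar>\<phi> x\<bar> \<le> B" "\<And>x. norm (\<phi>' x) \<le> B"
    using test_function_bounded[OF t] by metis
  note m = test_function_continuous(3,4)[OF t]
  have [measurable]: "f \<in> borel_measurable borel" using w unfolding has_weak_gradient_def by blast
  have [measurable]: "\<phi> \<in> borel_measurable borel" "\<phi>' \<in> borel_measurable borel" using m by auto
  have supp: "\<phi> (x - r *\<^sub>R e) = 0" if "norm x > R + K * norm e" "\<bar>r\<bar> \<le> K" for x r K
  proof (rule R)
    have "norm (r *\<^sub>R e) \<le> K * norm e" using that(2) by (simp add: mult_right_mono)
    then show "norm (x - r *\<^sub>R e) \<ge> R"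
      using that(1) norm_triangle_ineq2[of x "r *\<^sub>R e"] by linarith
  qed
  have int: "integrable lborel (\<lambda>x. f x * \<phi> (x - r *\<^sub>R e))" for r
    by (rule weak_gradient_mult_integrable(1)[OF w, of _ B "R + \<bar>r\<bar> * norm e"]) (use B supp in auto)
  let ?G = "\<lambda>s. \<integral>x. f x * \<phi> (x - s *\<^sub>R e) \<partial>lborel"
  let ?L = "\<integral>x. f x * (- (\<phi>' (x - s *\<^sub>R e) \<bullet> e)) \<partial>lborel"
  have L: "?L = (\<integral>x. \<phi> (x - s *\<^sub>R e) * (g x \<bullet> e) \<partial>lborel)"
    using weak_gradient_test_directional[OF w test_function_translate[OF t], of "s *\<^sub>R e" e] by simp
  have "(\<lambda>h. (?G (s + h) - ?G s) / h) \<midarrow>0\<rightarrow> ?L"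
    unfolding LIMSEQ_SEQ_conv[symmetric]
  proof (intro allI impI, elim conjE)
    fix S :: "nat \<Rightarrow> real" assume S0: "\<forall>n. S n \<noteq> 0" and S: "S \<longlonglongrightarrow> 0"
    obtain K0 where K0: "K0 > 0" "\<And>n. \<bar>S n\<bar> \<le> K0"
      using convergent_imp_Bseq[OF convergentI[OF S]] unfolding Bseq_def by auto
    define K where "K = \<bar>s\<bar> + K0"
    define b where "b n x = (\<phi> (x - (s + S n) *\<^sub>R e) - \<phi> (x - s *\<^sub>R e)) / S n" for n x
    have b_bd: "\<bar>b n x\<bar> \<le> B * norm e * indicator (cball 0 (R + K * norm e)) x" for n x
    proof (cases "norm x \<le> R + K * norm e")
      case True
      have "\<bar>\<phi> (x - (s + S n) *\<^sub>R e) - \<phi> (x - s *\<^sub>R e)\<bar> \<le> B * norm e * \<bar>S n\<bar>"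
        using test_function_lipschitz[OF t B(3), of x "s + S n" e s] by simp
      then show ?thesis using True S0 by (simp add: b_def divide_le_eq)
    next
      case False
      have "\<bar>s + S n\<bar> \<le> K" "\<bar>s\<bar> \<le> K" using K0(2)[of n] K0(1) unfolding K_def by linarith+
      then have "b n x = 0" using supp False unfolding b_def by (simp add: not_le)
      then show ?thesis using B(1) by simp
    qed
    have "(?G (s + S n) - ?G s) / S n = (\<integral>x. f x * b n x \<partial>lborel)" for n
    proof -
      have "?G (s + S n) - ?G s = (\<integral>x. f x * \<phi> (x - (s + S n) *\<^sub>R e) - f x * \<phi> (x - s *\<^sub>R e) \<partial>lborel)"
        by (rule Bochner_Integration.integral_diff[symmetric]) (rule int)+
      then show ?thesis by (simp add: b_def right_diff_distrib flip: integral_divide_zero)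
    qed
    moreover have "(\<lambda>n. \<integral>x. f x * b n x \<partial>lborel) \<longlonglongrightarrow> ?L"
    proof (rule integral_dominated_convergence[where
          w = "\<lambda>x. norm (f x * (B * norm e * indicator (cball 0 (R + K * norm e)) x))"])
      show "integrable lborel (\<lambda>x. norm (f x * (B * norm e * indicator (cball 0 (R + K * norm e)) x)))"
        by (rule integrable_norm, rule weak_gradient_mult_integrable(1)[OF w, of _ "B * norm e" "R + K * norm e"])
          (use B in \<open>auto simp: indicator_def\<close>)
      show "AE x in lborel. norm (f x * b n x) \<le> norm (f x * (B * norm e * indicator (cball 0 (R + K * norm e)) x))" for n
        by (rule AE_I2) (use b_bd B in \<open>auto simp: abs_mult intro!: mult_left_mono\<close>)
      show "AE x in lborel. (\<lambda>n. f x * b n x) \<longlonglongrightarrow> f x * (- (\<phi>' (x - s *\<^sub>R e) \<bullet> e))"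
      proof (rule AE_I2)
        fix x
        have "(\<lambda>h. (\<phi> (x - (s + h) *\<^sub>R e) - \<phi> (x - s *\<^sub>R e)) / h) \<midarrow>0\<rightarrow> - (\<phi>' (x - s *\<^sub>R e) \<bullet> e)"
          using test_function_directional_derivative[OF t, of x e s] unfolding DERIV_def .
        then have "(\<lambda>n. b n x) \<longlonglongrightarrow> - (\<phi>' (x - s *\<^sub>R e) \<bullet> e)"
          unfolding LIMSEQ_SEQ_conv[symmetric] b_def using S0 S by blast
        then show "(\<lambda>n. f x * b n x) \<longlonglongrightarrow> f x * (- (\<phi>' (x - s *\<^sub>R e) \<bullet> e))"
          by (intro tendsto_intros)
      qed
      show "(\<lambda>x. f x * b n x) \<in> borel_measurable lborel" for n unfolding b_def by measurable
      show "(\<lambda>x. f x * (- (\<phi>' (x - s *\<^sub>R e) \<bullet> e))) \<in> borel_measurable lborel" by measurable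
    qed
    ultimately show "(\<lambda>n. (?G (s + S n) - ?G s) / S n) \<longlonglongrightarrow> ?L" by presburger
  qed
  then show ?thesis unfolding DERIV_def L .
qed

text \<open>
  Let \<open>\<Psi>\<close> be the cutoff restricted to the set where \<open>f = 0\<close> and \<open>g \<bullet> e < 0\<close>.  The function
  \<open>G(s) = \<integral> f(x + s e) \<Psi>(x) dx\<close> is nonnegative and vanishes at \<open>s = 0\<close>, whereas its derivative there
  should be \<open>\<integral> (g \<bullet> e) \<Psi>\<close>, which is negative unless the set is null.  As \<open>\<Psi>\<close> is no test function, the
  mean value theorem is applied to test functions approximating it; the derivative stays away from zero
  uniformly in the approximation because translations are continuous in \<open>L\<^sup>1\<close>.
\<close>

lemma weak_gradient_halfspace_on_zero_set:
  fixes f :: "'a::euclidean_space \<Rightarrow> real"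
  assumes w: "has_weak_gradient f g" and f0: "\<And>x. f x \<ge> 0" and R: "R > 0" and e: "norm e = 1"
  shows "AE x in lborel. norm x < R \<longrightarrow> f x = 0 \<longrightarrow> g x \<bullet> e \<ge> 0"
proof -
  have [measurable]: "f \<in> borel_measurable borel" "g \<in> borel_measurable borel"
    using w unfolding has_weak_gradient_def by blast+
  define \<psi> where "\<psi> x = indicat_real {x. f x = 0 \<and> g x \<bullet> e < 0} x" for x :: 'a
  have \<psi>: "\<psi> \<in> borel_measurable borel" "\<bar>\<psi> x\<bar> \<le> 1" "\<psi> x \<ge> 0" for x
    unfolding \<psi>_def[abs_def] by (auto simp: indicator_def)
  define \<Psi> where "\<Psi> x = bump R x * \<psi> x" for x
  have \<Psi>_meas [measurable]: "\<Psi> \<in> borel_measurable borel" unfolding \<Psi>_def[abs_def] using \<psi>(1) by measurable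
  have \<Psi>0: "\<Psi> x \<ge> 0" for x unfolding \<Psi>_def by (intro mult_nonneg_nonneg bump_range \<psi>(3))
  have f\<Psi>: "f x * \<Psi> x = 0" for x by (simp add: \<Psi>_def \<psi>_def indicator_def)
  have g\<Psi>: "\<Psi> x * (g x \<bullet> e) \<le> 0" for x
    unfolding \<Psi>_def \<psi>_def using bump_range[of R x] by (auto simp: indicator_def mult_nonneg_nonpos)
  have \<Psi>1: "\<bar>\<Psi> x\<bar> \<le> 1" for x
    unfolding \<Psi>_def abs_mult by (intro mult_le_one) (use bump_range[of R x] \<psi>(2) in auto)
  have \<Psi>_out: "\<Psi> x = 0" if "norm x \<ge> R" for x unfolding \<Psi>_def using bump_outside[OF R that] by simp
  obtain \<phi> \<phi>' where \<phi>: "\<And>n. test_function (\<phi> n) (\<phi>' n)"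
    "\<And>n x. \<bar>\<phi> n x\<bar> \<le> 2" "\<And>n x. norm x \<ge> R \<Longrightarrow> \<phi> n x = 0"
    "AE x in lborel. (\<lambda>n::nat. \<phi> n x) \<longlonglongrightarrow> \<Psi> x"
    by (rule bounded_approx_by_test_functions[OF \<psi>(1,2) R])
      (rule that, assumption+, simp add: \<Psi>_def)
  have [measurable]: "\<phi> n \<in> borel_measurable borel" for n
    using test_function_continuous[OF \<phi>(1)] by simp
  have \<phi>_ind: "\<bar>\<phi> n x\<bar> \<le> 2 * indicator (cball 0 (R + 1)) x" for n x
    using \<phi>(2)[of n x] \<phi>(3)[of x n] by (cases "norm x \<le> R + 1") auto
  define F where "F x = f x * indicator (cball 0 (R + 1)) x" for x
  define h where "h x = indicator (cball 0 (R + 1)) x * (g x \<bullet> e)" for x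
  have iF: "integrable lborel F" and ih: "integrable lborel h"
    unfolding F_def h_def
    by (rule weak_gradient_mult_integrable[OF w, of _ 1 "R + 1"]; auto simp: indicator_def)+
  have [measurable]: "F \<in> borel_measurable borel" "h \<in> borel_measurable borel"
    using borel_measurable_integrable[OF iF] borel_measurable_integrable[OF ih] by simp_all
  have lim: "(\<lambda>n. \<integral>x. u x * \<phi> n x \<partial>lborel) \<longlonglongrightarrow> (\<integral>x. u x * \<Psi> x \<partial>lborel)"
    if u: "integrable lborel u" for u :: "'a \<Rightarrow> real"
  proof (rule integral_dominated_convergence[where w = "\<lambda>x. 2 * norm (u x)"])
    have [measurable]: "u \<in> borel_measurable borel" using borel_measurable_integrable[OF u] by simp
    show "(\<lambda>x. u x * \<phi> n x) \<in> borel_measurable lborel" for n by measurable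
    show "(\<lambda>x. u x * \<Psi> x) \<in> borel_measurable lborel" by measurable
    show "integrable lborel (\<lambda>x. 2 * norm (u x))" using u by simp
    show "AE x in lborel. (\<lambda>n. u x * \<phi> n x) \<longlonglongrightarrow> u x * \<Psi> x"
      using \<phi>(4) by eventually_elim (intro tendsto_intros)
    show "AE x in lborel. norm (u x * \<phi> n x) \<le> 2 * norm (u x)" for n
      by (rule AE_I2) (use \<phi>(2)[of n] in \<open>auto simp: abs_mult mult.commute[of 2] intro: mult_left_mono\<close>)
  qed
  define a where "a = (\<integral>x. h x * \<Psi> x \<partial>lborel)"
  have h\<Psi>: "h x * \<Psi> x = \<Psi> x * (g x \<bullet> e)" for x
    using \<Psi>_out[of x] by (cases "norm x \<le> R + 1") (auto simp: h_def)
  have "a \<ge> 0"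
  proof (rule ccontr)
    assume "\<not> a \<ge> 0"
    then have "- a / 8 > 0" by simp
    then obtain \<delta> where \<delta>: "\<delta> > 0" "\<And>s. \<bar>s\<bar> \<le> \<delta> \<Longrightarrow> (\<integral>x. \<bar>h (x + s *\<^sub>R e) - h x\<bar> \<partial>lborel) < - a / 8"
      using L1_translation_continuous[OF ih, of "- a / 8" e] by blast
    \<comment> \<open>shifts of length at most \<open>1\<close> keep all supports inside the ball of radius \<open>R + 1\<close>, where \<open>f\<close> and \<open>g\<close> are integrable\<close>
    define t where "t = min 1 \<delta>"
    have t: "t > 0" "t \<le> 1" "t \<le> \<delta>" using \<delta>(1) by (auto simp: t_def)
    have shift: "u x * indicator (cball 0 (R + 1)) x * \<phi> n (x - s *\<^sub>R e) = u x * \<phi> n (x - s *\<^sub>R e)"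
      if "0 \<le> s" "s \<le> t" for n x s and u :: "'a \<Rightarrow> real"
    proof (cases "norm x \<le> R + 1")
      case False
      have "norm (s *\<^sub>R e) \<le> 1" using that t e by simp
      then have "norm (x - s *\<^sub>R e) \<ge> R" using False norm_triangle_ineq2[of x "s *\<^sub>R e"] by linarith
      then show ?thesis using \<phi>(3) by simp
    qed simp
    define G where "G n s = (\<integral>x. f x * \<phi> n (x - s *\<^sub>R e) \<partial>lborel)" for n s
    define J where "J n s = (\<integral>x. \<phi> n (x - s *\<^sub>R e) * (g x \<bullet> e) \<partial>lborel)" for n s
    have translate: "(\<integral>x. u x * \<phi> n (x - s *\<^sub>R e) \<partial>lborel) = (\<integral>x. u (x + s *\<^sub>R e) * \<phi> n x \<partial>lborel)"
      if u: "integrable lborel u" for n s and u :: "'a \<Rightarrow> real"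
    proof -
      have "integrable lborel (\<lambda>x. u x * \<phi> n (x - s *\<^sub>R e))"
      proof (rule Bochner_Integration.integrable_bound)
        show "integrable lborel (\<lambda>x. 2 * norm (u x))" using u by simp
        have [measurable]: "u \<in> borel_measurable borel" using borel_measurable_integrable[OF u] by simp
        show "(\<lambda>x. u x * \<phi> n (x - s *\<^sub>R e)) \<in> borel_measurable lborel" by measurable
        show "AE x in lborel. norm (u x * \<phi> n (x - s *\<^sub>R e)) \<le> norm (2 * norm (u x))"
          by (rule AE_I2) (use \<phi>(2)[of n] in \<open>auto simp: abs_mult mult.commute[of 2] intro: mult_left_mono\<close>)
      qed
      from lborel_translate(2)[OF this, of "s *\<^sub>R e"] show ?thesis by simp
    qed
    have G_eq: "G n s = (\<integral>x. F (x + s *\<^sub>R e) * \<phi> n x \<partial>lborel)" if "0 \<le> s" "s \<le> t" for n s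
    proof -
      have "G n s = (\<integral>x. F x * \<phi> n (x - s *\<^sub>R e) \<partial>lborel)"
        unfolding G_def F_def by (simp only: shift[OF that, of f _ n])
      then show ?thesis using translate[OF iF] by simp
    qed
    have J_eq: "J n s = (\<integral>x. h (x + s *\<^sub>R e) * \<phi> n x \<partial>lborel)" if "0 \<le> s" "s \<le> t" for n s
    proof -
      have eq: "\<phi> n (x - s *\<^sub>R e) * (g x \<bullet> e) = h x * \<phi> n (x - s *\<^sub>R e)" for x
        using shift[OF that, of "\<lambda>x. g x \<bullet> e" x n] unfolding h_def by (simp only: mult.commute mult.left_commute)
      show ?thesis unfolding J_def eq by (rule translate[OF ih])
    qed
    have J_close: "J n s \<le> J n 0 - a / 4" if s: "0 \<le> s" "s \<le> t" for n s
    proof -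
      have int: "integrable lborel (\<lambda>x. u x * \<phi> n x)" if u: "integrable lborel u" for u :: "'a \<Rightarrow> real"
      proof (rule Bochner_Integration.integrable_bound)
        show "integrable lborel (\<lambda>x. 2 * norm (u x))" using u by simp
        have [measurable]: "u \<in> borel_measurable borel" using borel_measurable_integrable[OF u] by simp
        show "(\<lambda>x. u x * \<phi> n x) \<in> borel_measurable lborel" by measurable
        show "AE x in lborel. norm (u x * \<phi> n x) \<le> norm (2 * norm (u x))"
          by (rule AE_I2) (use \<phi>(2)[of n] in \<open>auto simp: abs_mult mult.commute[of 2] intro: mult_left_mono\<close>)
      qed
      have ihs: "integrable lborel (\<lambda>x. h (x + s *\<^sub>R e))" by (rule lborel_translate(1)[OF ih])
      have "J n s - J n 0 = (\<integral>x. h (x + s *\<^sub>R e) * \<phi> n x - h x * \<phi> n x \<partial>lborel)"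
        using J_eq[OF s] J_eq[of 0 n] t(1) int[OF ih] int[OF ihs] by simp
      also have "\<dots> \<le> (\<integral>x. 2 * \<bar>h (x + s *\<^sub>R e) - h x\<bar> \<partial>lborel)"
      proof (rule integral_mono)
        show "integrable lborel (\<lambda>x. h (x + s *\<^sub>R e) * \<phi> n x - h x * \<phi> n x)"
          by (intro Bochner_Integration.integrable_diff int ih ihs)
        show "integrable lborel (\<lambda>x. 2 * \<bar>h (x + s *\<^sub>R e) - h x\<bar>)" using ih ihs by simp
        show "h (x + s *\<^sub>R e) * \<phi> n x - h x * \<phi> n x \<le> 2 * \<bar>h (x + s *\<^sub>R e) - h x\<bar>" for x
        proof -
          have "h (x + s *\<^sub>R e) * \<phi> n x - h x * \<phi> n x \<le> \<bar>\<phi> n x\<bar> * \<bar>h (x + s *\<^sub>R e) - h x\<bar>"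
            unfolding abs_mult[symmetric] by (simp add: algebra_simps)
          also have "\<dots> \<le> 2 * \<bar>h (x + s *\<^sub>R e) - h x\<bar>"
            by (intro mult_right_mono \<phi>) auto
          finally show ?thesis .
        qed
      qed
      also have "\<dots> \<le> - a / 4" using \<delta>(2)[of s] s t by simp
      finally show ?thesis by simp
    qed
    have "(\<lambda>n. J n 0) \<longlonglongrightarrow> a" using lim[OF ih] J_eq[of 0] t(1) unfolding a_def by simp
    then have "\<forall>\<^sub>F n in sequentially. J n 0 < 3 * a / 4"
      by (rule order_tendstoD(2)) (use \<open>\<not> a \<ge> 0\<close> in auto)
    then have "\<forall>\<^sub>F n in sequentially. G n t - G n 0 \<le> t * (a / 2)"
    proof eventually_elim
      case (elim n)
      obtain s where s: "0 < s" "s < t" "G n t - G n 0 = (t - 0) * J n s"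
        using MVT2[OF t(1), of "G n" "J n"] DERIV_translated_pairing[OF w \<phi>(1)] unfolding G_def J_def by blast
      have "J n s \<le> a / 2" using J_close[of s n] s elim by linarith
      then show ?case using s(3) t(1) by simp
    qed
    moreover have "(\<lambda>n. G n t - G n 0) \<longlonglongrightarrow> (\<integral>x. F (x + t *\<^sub>R e) * \<Psi> x \<partial>lborel) - (\<integral>x. F x * \<Psi> x \<partial>lborel)"
      using tendsto_diff[OF lim[OF lborel_translate(1)[OF iF]] lim[OF iF]] G_eq[of t] G_eq[of 0] t(1) by simp
    ultimately have "(\<integral>x. F (x + t *\<^sub>R e) * \<Psi> x \<partial>lborel) - (\<integral>x. F x * \<Psi> x \<partial>lborel) \<le> t * (a / 2)"
      using tendsto_upperbound trivial_limit_sequentially by blast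
    moreover have "F x * \<Psi> x = 0" for x using f\<Psi>[of x] by (auto simp: F_def)
    moreover have "(\<integral>x. F (x + t *\<^sub>R e) * \<Psi> x \<partial>lborel) \<ge> 0"
      by (rule integral_nonneg_AE, rule AE_I2) (use f0 \<Psi>0 in \<open>auto simp: F_def\<close>)
    ultimately have "t * (a / 2) \<ge> 0" by simp
    then show False using t(1) \<open>\<not> a \<ge> 0\<close> by (simp add: zero_le_mult_iff)
  qed
  have int: "integrable lborel (\<lambda>x. - (\<Psi> x * (g x \<bullet> e)))"
    by (intro integrable_minus, rule weak_gradient_mult_integrable(2)[OF w, of _ 1 R])
      (use \<Psi>1 \<Psi>_out in auto)
  have "(\<integral>x. - (\<Psi> x * (g x \<bullet> e)) \<partial>lborel) = - a" unfolding a_def h\<Psi> by simp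
  moreover have "(\<integral>x. - (\<Psi> x * (g x \<bullet> e)) \<partial>lborel) \<ge> 0"
    by (rule integral_nonneg_AE, rule AE_I2) (use g\<Psi> in auto)
  ultimately have "(\<integral>x. - (\<Psi> x * (g x \<bullet> e)) \<partial>lborel) = 0" using \<open>a \<ge> 0\<close> by linarith
  then have "AE x in lborel. - (\<Psi> x * (g x \<bullet> e)) = 0"
    by (subst (asm) integral_nonneg_eq_0_iff_AE[OF int]) (use g\<Psi> in auto)
  then show ?thesis
  proof eventually_elim
    case (elim x)
    show ?case
    proof (intro impI)
      assume x: "norm x < R" "f x = 0"
      show "g x \<bullet> e \<ge> 0"
      proof (rule ccontr)
        assume "\<not> g x \<bullet> e \<ge> 0"
        then have "\<Psi> x > 0" using x bump_pos[OF x(1)] by (simp add: \<Psi>_def \<psi>_def)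
        then show False using elim \<open>\<not> g x \<bullet> e \<ge> 0\<close> by simp
      qed
    qed
  qed
qed

text \<open>
  A nonnegative function is minimal where it vanishes.  Each axis is treated together with its
  opposite, so that the directional inequality becomes an equality.
\<close>

lemma weak_gradient_zero_on_zero_set:
  fixes f :: "'a::euclidean_space \<Rightarrow> real"
  assumes w: "has_weak_gradient f g" and f0: "\<And>x. f x \<ge> 0"
  shows "AE x in lborel. f x = 0 \<longrightarrow> g x = 0"
proof -
  have "AE x in lborel. \<forall>n::nat. \<forall>b\<in>Basis. norm x < real (Suc n) \<longrightarrow> f x = 0 \<longrightarrow> g x \<bullet> b = 0"
    unfolding AE_all_countable
  proof (intro allI AE_finite_allI finite_Basis)
    fix n :: nat and b :: 'a assume b: "b \<in> Basis"
    have "AE x in lborel. norm x < real (Suc n) \<longrightarrow> f x = 0 \<longrightarrow> g x \<bullet> b \<ge> 0"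
      "AE x in lborel. norm x < real (Suc n) \<longrightarrow> f x = 0 \<longrightarrow> g x \<bullet> - b \<ge> 0"
      by (rule weak_gradient_halfspace_on_zero_set[OF w f0]; use b in simp)+
    then show "AE x in lborel. norm x < real (Suc n) \<longrightarrow> f x = 0 \<longrightarrow> g x \<bullet> b = 0"
      by eventually_elim auto
  qed
  then show ?thesis
  proof eventually_elim
    case (elim x)
    obtain n where "norm x < real n" using reals_Archimedean2 by blast
    then have "norm x < real (Suc n)" by simp
    then show ?case using elim by (auto intro: euclidean_eqI)
  qed
qed

section \<open>Weak gradients tested against functions of quadratic growth\<close>

lemma bump_grad_tendsto: "(\<lambda>n. bump_grad (real (Suc n)) x) \<longlonglongrightarrow> 0"
proof (rule Lim_null_comparison)
  show "\<forall>\<^sub>F n in sequentially. norm (bump_grad (real (Suc n)) x) \<le> 4 * norm x / (real (Suc n))\<^sup>2"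
    by (intro always_eventually allI norm_bump_grad) simp
  show "(\<lambda>n. 4 * norm x / (real (Suc n))\<^sup>2) \<longlonglongrightarrow> 0"
    by (intro tendsto_divide_0[OF tendsto_const] filterlim_at_top_imp_at_infinity filterlim_pow_at_top)
      (use filterlim_sequentially_Suc[of real] filterlim_real_sequentially in auto)
qed

text \<open>
  On the support of the cutoff of radius \<open>R\<close> its gradient is at most \<open>4 / R\<close>, so the error
  \<open>f l (\<nabla>bump \<bullet> r)\<close> is dominated by a multiple of \<open>(1 + |x|\<^sup>2) f\<close> and tends to \<open>0\<close> pointwise.  The
  limit on the left exists although \<open>l (g \<bullet> r)\<close> may fail to be integrable.
\<close>

lemma weak_gradient_moment:
  fixes f :: "'a::euclidean_space \<Rightarrow> real"
  assumes w: "has_weak_gradient f g"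
    and l: "\<And>x. GDERIV l x :> l' x" "continuous_on UNIV l'"
    and l_bd: "\<And>x. \<bar>l x\<bar> \<le> C * (1 + (norm x)\<^sup>2)" "\<And>x. norm (l' x) \<le> C * (1 + (norm x)\<^sup>2)"
    and f: "integrable lborel (\<lambda>x. (1 + (norm x)\<^sup>2) * f x)"
  shows "(\<lambda>n. \<integral>x. l x * bump (real (Suc n)) x * (g x \<bullet> r) \<partial>lborel) \<longlonglongrightarrow> - (\<integral>x. f x * (l' x \<bullet> r) \<partial>lborel)"
proof -
  have [measurable]: "f \<in> borel_measurable borel" using w unfolding has_weak_gradient_def by blast
  have [measurable]: "l \<in> borel_measurable borel" "l' \<in> borel_measurable borel"
    using GDERIV_continuous_on[OF l(1)] l(2) by (auto intro: borel_measurable_continuous_onI)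
  have "C \<ge> 0" using l_bd(1)[of 0] by simp
  let ?D = "\<lambda>R x. l x *\<^sub>R bump_grad R x + bump R x *\<^sub>R l' x"
  have eq: "(\<integral>x. l x * bump (real (Suc n)) x * (g x \<bullet> r) \<partial>lborel) = - (\<integral>x. f x * (?D (real (Suc n)) x \<bullet> r) \<partial>lborel)" for n
    using weak_gradient_test_directional[OF w test_function_bump_mult[of "real (Suc n)" l l'], OF _ l] by simp
  have "(\<lambda>n. \<integral>x. f x * (?D (real (Suc n)) x \<bullet> r) \<partial>lborel) \<longlonglongrightarrow> (\<integral>x. f x * (l' x \<bullet> r) \<partial>lborel)"
  proof (rule integral_dominated_convergence[where w = "\<lambda>x. 5 * C * norm r * norm ((1 + (norm x)\<^sup>2) * f x)"])
    show "integrable lborel (\<lambda>x. 5 * C * norm r * norm ((1 + (norm x)\<^sup>2) * f x))"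
      by (intro integrable_mult_right integrable_norm f)
    show "AE x in lborel. (\<lambda>n. f x * (?D (real (Suc n)) x \<bullet> r)) \<longlonglongrightarrow> f x * (l' x \<bullet> r)"
    proof (rule AE_I2)
      fix x
      have "(\<lambda>n. f x * (?D (real (Suc n)) x \<bullet> r)) \<longlonglongrightarrow> f x * ((l x *\<^sub>R 0 + 1 *\<^sub>R l' x) \<bullet> r)"
        by (intro tendsto_intros bump_grad_tendsto bump_tendsto)
      then show "(\<lambda>n. f x * (?D (real (Suc n)) x \<bullet> r)) \<longlonglongrightarrow> f x * (l' x \<bullet> r)" by simp
    qed
    show "AE x in lborel. norm (f x * (?D (real (Suc n)) x \<bullet> r)) \<le> 5 * C * norm r * norm ((1 + (norm x)\<^sup>2) * f x)" for n
    proof (rule AE_I2)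
      fix x :: 'a
      define R where "R = real (Suc n)"
      define P where "P = C * (1 + (norm x)\<^sup>2)"
      have R1: "R \<ge> 1" by (simp add: R_def)
      have "P \<ge> 0" using l_bd(1)[of x] unfolding P_def by linarith
      have "norm (bump_grad R x) \<le> 4"
      proof (cases "norm x \<le> R")
        case True
        have "norm x / R\<^sup>2 \<le> R / R\<^sup>2" using True by (simp add: divide_right_mono)
        also have "\<dots> \<le> 1" using R1 by (simp add: power2_eq_square)
        finally have "4 * norm x / R\<^sup>2 \<le> 4" by simp
        then show ?thesis using norm_bump_grad[of R x] R1 by linarith
      qed (use bump_outside(2)[of R x] R1 in auto)
      then have "norm (l x *\<^sub>R bump_grad R x) \<le> P * 4"
        unfolding norm_scaleR by (intro mult_mono) (use l_bd(1)[of x] \<open>P \<ge> 0\<close> in \<open>auto simp: P_def\<close>)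
      moreover have "norm (bump R x *\<^sub>R l' x) \<le> 1 * P"
        unfolding norm_scaleR by (intro mult_mono) (use bump_range[of R x] l_bd(2)[of x] in \<open>auto simp: P_def\<close>)
      ultimately have "norm (?D R x) \<le> 5 * P" using norm_triangle_ineq[of "l x *\<^sub>R bump_grad R x" "bump R x *\<^sub>R l' x"] by linarith
      then have "\<bar>?D R x \<bullet> r\<bar> \<le> 5 * P * norm r"
        using Cauchy_Schwarz_ineq2[of "?D R x" r] by (meson mult_right_mono norm_ge_zero order_trans)
      then have "\<bar>f x\<bar> * \<bar>?D R x \<bullet> r\<bar> \<le> \<bar>f x\<bar> * (5 * P * norm r)" by (rule mult_left_mono) simp
      also have "\<dots> = 5 * C * norm r * norm ((1 + (norm x)\<^sup>2) * f x)"
        by (subst real_norm_def, subst abs_mult, subst abs_of_nonneg[of "1 + (norm x)\<^sup>2"])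
          (simp_all add: P_def mult_ac)
      finally show "norm (f x * (?D (real (Suc n)) x \<bullet> r)) \<le> 5 * C * norm r * norm ((1 + (norm x)\<^sup>2) * f x)"
        unfolding real_norm_def abs_mult R_def .
    qed
  qed auto
  then show ?thesis unfolding eq by (rule tendsto_minus)
qed

section \<open>The Landau integrand controls wedge products\<close>

lemma landau_integrand_inner:
  "landau_integrand f g v w = inverse (norm (v - w)) *
     ((norm (g v /\<^sub>R f v - g w /\<^sub>R f w))\<^sup>2 - ((v - w) \<bullet> (g v /\<^sub>R f v - g w /\<^sub>R f w))\<^sup>2 / (norm (v - w))\<^sup>2) * (f v * f w)"
proof -
  define z where "z = v - w"
  define x where "x = g v /\<^sub>R f v - g w /\<^sub>R f w"
  have x: "g v $ i / f v - g w $ i / f w = x $ i" for i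
    by (simp add: x_def divide_inverse mult.commute)
  have "landau_integrand f g v w
      = (\<Sum>i\<in>UNIV. \<Sum>j\<in>UNIV. coulomb_matrix z $ i $ j * x $ i * x $ j) * (f v * f w)"
    unfolding landau_integrand_def x z_def[symmetric] by (simp add: sum_distrib_right mult.assoc)
  also have "(\<Sum>i\<in>UNIV. \<Sum>j\<in>UNIV. coulomb_matrix z $ i $ j * x $ i * x $ j)
      = inverse (norm z) * ((x \<bullet> x) - (z \<bullet> x)\<^sup>2 / (norm z)\<^sup>2)"
    unfolding coulomb_matrix_def proj_perp_def inner_vec_def sum_3
    by (simp add: algebra_simps power2_eq_square add_divide_distrib)
  finally show ?thesis unfolding z_def x_def power2_norm_eq_inner .
qed

text \<open>
  The vector \<open>u = (z \<bullet> p) q - (z \<bullet> q) p\<close> is orthogonal to \<open>z\<close> and not longer than \<open>z\<close>, and the left-hand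
  side is \<open>(x \<bullet> u)\<^sup>2\<close>.  Hence only the part of \<open>x\<close> orthogonal to \<open>z\<close> matters, and the Cauchy-Schwarz
  inequality for it and \<open>u\<close> gives the bound.
\<close>

lemma wedge_component_le:
  fixes p q z x :: "'a::real_inner"
  assumes pq: "norm p = 1" "norm q = 1" "p \<bullet> q = 0"
  shows "((z \<bullet> p) * (x \<bullet> q) - (z \<bullet> q) * (x \<bullet> p))\<^sup>2 \<le> (norm z)\<^sup>2 * (norm x)\<^sup>2 - (z \<bullet> x)\<^sup>2"
proof -
  have pp: "p \<bullet> p = 1" "q \<bullet> q = 1" "q \<bullet> p = 0" using pq by (auto simp: norm_eq_1 inner_commute)
  define a b where "a = z \<bullet> p" and "b = z \<bullet> q"
  define u where "u = a *\<^sub>R q - b *\<^sub>R p"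
  have zu: "z \<bullet> u = 0" by (simp add: u_def inner_diff_right a_def b_def)
  have uu: "u \<bullet> u = a\<^sup>2 + b\<^sup>2"
    by (simp add: u_def inner_diff_left inner_diff_right pp pq(3) power2_eq_square)
  have "0 \<le> (z - a *\<^sub>R p - b *\<^sub>R q) \<bullet> (z - a *\<^sub>R p - b *\<^sub>R q)" by simp
  also have "\<dots> = z \<bullet> z - (a\<^sup>2 + b\<^sup>2)"
    by (simp add: inner_diff_left inner_diff_right pp pq(3) power2_eq_square a_def b_def inner_commute)
  finally have u_le: "u \<bullet> u \<le> z \<bullet> z" using uu by simp
  define y where "y = (z \<bullet> z) *\<^sub>R x - (z \<bullet> x) *\<^sub>R z"
  have yy: "y \<bullet> y = (z \<bullet> z) * ((z \<bullet> z) * (x \<bullet> x) - (z \<bullet> x)\<^sup>2)"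
    by (simp add: y_def inner_diff_left inner_diff_right power2_eq_square algebra_simps inner_commute)
  have yu: "y \<bullet> u = (z \<bullet> z) * (x \<bullet> u)" by (simp add: y_def inner_diff_left zu)
  have "(y \<bullet> u)\<^sup>2 \<le> (y \<bullet> y) * (u \<bullet> u)" by (rule Cauchy_Schwarz_ineq)
  also have "\<dots> \<le> (y \<bullet> y) * (z \<bullet> z)" by (intro mult_left_mono u_le) simp
  finally have *: "(z \<bullet> z)\<^sup>2 * (x \<bullet> u)\<^sup>2 \<le> (z \<bullet> z)\<^sup>2 * ((z \<bullet> z) * (x \<bullet> x) - (z \<bullet> x)\<^sup>2)"
    unfolding yu yy power_mult_distrib by (simp add: power2_eq_square mult_ac)
  have xu: "x \<bullet> u = (z \<bullet> p) * (x \<bullet> q) - (z \<bullet> q) * (x \<bullet> p)"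
    by (simp add: u_def inner_diff_right a_def b_def)
  show ?thesis
  proof (cases "z = 0")
    case False
    then have "(z \<bullet> z)\<^sup>2 > 0" by simp
    then show ?thesis using mult_left_le_imp_le[OF *] unfolding xu power2_norm_eq_inner by simp
  qed simp
qed

lemma landau_integrand_ge:
  fixes f :: "real^3 \<Rightarrow> real" and g :: "real^3 \<Rightarrow> real^3"
  assumes pq: "norm p = 1" "norm q = 1" "p \<bullet> q = 0" and f: "\<And>v. f v \<ge> 0"
  defines "F \<equiv> \<lambda>v. g v /\<^sub>R f v"
  shows "inverse ((norm (v - w)) ^ 3) *
      (((v - w) \<bullet> p) * ((F v - F w) \<bullet> q) - ((v - w) \<bullet> q) * ((F v - F w) \<bullet> p))\<^sup>2 * (f v * f w)
    \<le> landau_integrand f g v w"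
proof (cases "v = w")
  case True
  then show ?thesis using landau_integrand_nonneg[of f g] f by simp
next
  case False
  define n where "n = norm (v - w)"
  have n: "n > 0" using False by (simp add: n_def)
  define S where "S = (norm (F v - F w))\<^sup>2"
  define I where "I = (v - w) \<bullet> (F v - F w)"
  have "inverse (n ^ 3) * (((v - w) \<bullet> p) * ((F v - F w) \<bullet> q) - ((v - w) \<bullet> q) * ((F v - F w) \<bullet> p))\<^sup>2
      \<le> inverse (n ^ 3) * (n\<^sup>2 * S - I\<^sup>2)"
    unfolding n_def S_def I_def by (intro mult_left_mono wedge_component_le pq) simp
  also have "\<dots> = inverse n * (S - I\<^sup>2 / n\<^sup>2)"
    using n by (simp add: field_simps power2_eq_square power3_eq_cube)
  finally show ?thesis
    unfolding landau_integrand_inner n_def S_def I_def F_def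
    by (rule mult_right_mono) (simp add: f)
qed
lemma norm_le_quadratic: "norm v \<le> 1 + (norm v)\<^sup>2"
proof -
  have "0 \<le> (norm v - 1)\<^sup>2 + (norm v)\<^sup>2 + 1" by simp
  then show ?thesis by (simp add: power2_eq_square algebra_simps)
qed

lemma inner_mult_le: "\<bar>(v \<bullet> p) * (v \<bullet> q)\<bar> \<le> (norm p * norm q) * (1 + (norm v)\<^sup>2)"
proof -
  have "\<bar>(v \<bullet> p) * (v \<bullet> q)\<bar> \<le> (norm v * norm p) * (norm v * norm q)"
    unfolding abs_mult by (intro mult_mono Cauchy_Schwarz_ineq2) auto
  also have "\<dots> = (norm p * norm q) * (norm v)\<^sup>2" by (simp add: power2_eq_square mult_ac)
  also have "\<dots> \<le> (norm p * norm q) * (1 + (norm v)\<^sup>2)" by (intro mult_left_mono) auto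
  finally show ?thesis .
qed

lemma japanese_bracket_ge: "1 \<le> japanese_bracket v" "norm v \<le> japanese_bracket v" "(norm v)\<^sup>2 \<le> (japanese_bracket v)\<^sup>2"
  unfolding japanese_bracket_def by (auto intro: real_le_rsqrt)

lemma japanese_bracket_measurable [measurable]:
  "(japanese_bracket :: 'a::euclidean_space \<Rightarrow> real) \<in> borel_measurable borel"
  unfolding japanese_bracket_def[abs_def] by measurable

text \<open>
  From \<open>|v - w| \<le> \<langle>v\<rangle> + \<langle>w\<rangle> \<le> 2 \<langle>v\<rangle> \<langle>w\<rangle>\<close>, where the last step uses that both brackets are at least \<open>1\<close>.
\<close>

lemma cubic_weight_le:
  "(norm (v - w)) ^ 3 * (norm w)\<^sup>2 \<le> 8 * (japanese_bracket v) ^ 3 * (japanese_bracket w) ^ 5"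
proof -
  let ?a = "japanese_bracket v" and ?b = "japanese_bracket w"
  have "norm (v - w) \<le> ?a + ?b"
    using norm_triangle_ineq4[of v w] japanese_bracket_ge(2)[of v] japanese_bracket_ge(2)[of w] by linarith
  also have "\<dots> \<le> ?a * ?b + ?a * ?b"
    using japanese_bracket_ge(1)[of v] japanese_bracket_ge(1)[of w]
    by (intro add_mono) (auto simp: mult_le_cancel_left1 mult_le_cancel_right1)
  finally have "norm (v - w) \<le> 2 * (?a * ?b)" by simp
  then have "(norm (v - w)) ^ 3 * (norm w)\<^sup>2 \<le> (2 * (?a * ?b)) ^ 3 * ?b\<^sup>2"
    by (intro mult_mono power_mono japanese_bracket_ge)
      (use japanese_bracket_ge(1)[of v] japanese_bracket_ge(1)[of w] in auto)
  also have "\<dots> = 8 * ?a ^ 3 * ?b ^ 5"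
    by (simp add: power_mult_distrib mult_ac flip: power_add)
  finally show ?thesis .
qed

section \<open>From the dissipation to the residuals of the score\<close>

locale normalized_density =
  fixes f :: "real^3 \<Rightarrow> real" and g :: "real^3 \<Rightarrow> real^3"
  assumes nonneg: "\<And>v. f v \<ge> 0"
    and weak_gradient: "has_weak_gradient f g"
    and mass: "has_bochner_integral lborel f 1"
    and momentum: "has_bochner_integral lborel (\<lambda>v. f v *\<^sub>R v) 0"
    and energy: "has_bochner_integral lborel (\<lambda>v. f v * (norm v)\<^sup>2) 3"
begin

lemma measurable_fg [measurable]: "f \<in> borel_measurable borel" "g \<in> borel_measurable borel"
  using weak_gradient unfolding has_weak_gradient_def by blast+

lemma integrable_f: "integrable lborel f" and integral_f: "(\<integral>v. f v \<partial>lborel) = 1"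
  using mass by (auto simp: has_bochner_integral_iff)

lemma integrable_energy: "integrable lborel (\<lambda>v. (1 + (norm v)\<^sup>2) * f v)"
  using integrable_f energy by (auto simp: has_bochner_integral_iff algebra_simps)

lemma integrable_quadratic:
  assumes [measurable]: "b \<in> borel_measurable borel" and b: "\<And>v. \<bar>b v\<bar> \<le> C * (1 + (norm v)\<^sup>2)"
  shows "integrable lborel (\<lambda>v. f v * b v)"
proof (rule Bochner_Integration.integrable_bound)
  show "integrable lborel (\<lambda>v. C * ((1 + (norm v)\<^sup>2) * f v))"
    by (intro integrable_mult_right integrable_energy)
  show "AE v in lborel. norm (f v * b v) \<le> norm (C * ((1 + (norm v)\<^sup>2) * f v))"
  proof (rule AE_I2)
    fix v
    have "f v * \<bar>b v\<bar> \<le> f v * (C * (1 + (norm v)\<^sup>2))" by (intro mult_left_mono b nonneg)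
    then show "norm (f v * b v) \<le> norm (C * ((1 + (norm v)\<^sup>2) * f v))"
      using nonneg[of v] abs_ge_self[of "C * ((1 + (norm v)\<^sup>2) * f v)"] by (simp add: abs_mult mult_ac)
  qed
qed simp

lemma integrable_inner: "integrable lborel (\<lambda>v. f v * (v \<bullet> p))"
proof (rule integrable_quadratic)
  fix v
  have "\<bar>v \<bullet> p\<bar> \<le> norm v * norm p" by (rule Cauchy_Schwarz_ineq2)
  also have "\<dots> \<le> (1 + (norm v)\<^sup>2) * norm p" by (intro mult_right_mono norm_le_quadratic) simp
  finally show "\<bar>v \<bullet> p\<bar> \<le> norm p * (1 + (norm v)\<^sup>2)" by (simp add: mult.commute)
qed simp

lemma integral_inner: "(\<integral>v. f v * (v \<bullet> p) \<partial>lborel) = 0"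
proof -
  have "(\<integral>v. f v * (v \<bullet> p) \<partial>lborel) = (\<integral>v. (f v *\<^sub>R v) \<bullet> p \<partial>lborel)" by simp
  also have "\<dots> = (\<integral>v. f v *\<^sub>R v \<partial>lborel) \<bullet> p"
    by (rule integral_inner_left) (use momentum in \<open>simp add: has_bochner_integral_iff\<close>)
  also have "\<dots> = 0" using momentum by (simp add: has_bochner_integral_iff)
  finally show ?thesis .
qed

definition second_moment :: "real^3 \<Rightarrow> real^3 \<Rightarrow> real"
  where "second_moment p q = (\<integral>v. f v * ((v \<bullet> p) * (v \<bullet> q)) \<partial>lborel)"

lemma integrable_second_moment: "integrable lborel (\<lambda>v. f v * ((v \<bullet> p) * (v \<bullet> q)))"
  by (rule integrable_quadratic[where C = "norm p * norm q"]) (use inner_mult_le in auto)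

definition score :: "real^3 \<Rightarrow> real^3"
  where "score v = g v /\<^sub>R f v"

lemma score_measurable [measurable]: "score \<in> borel_measurable borel"
  unfolding score_def[abs_def] by measurable

definition wedge :: "real^3 \<Rightarrow> real^3 \<Rightarrow> real^3 \<Rightarrow> real^3 \<Rightarrow> real"
  where "wedge p q v w = ((v - w) \<bullet> p) * ((score v - score w) \<bullet> q) - ((v - w) \<bullet> q) * ((score v - score w) \<bullet> p)"

text \<open>
  Multiplied by \<open>f(w)\<close>, the wedge component splits into a part with \<open>F(v)\<close> and a part with \<open>\<nabla>f(w)\<close>.
  The first integrates to \<open>T\<^sub>q (F(v) \<bullet> p)\<close>: the terms linear in \<open>w\<close> vanish by the zero momentum, and the
  mixed second moment vanishes by assumption.  The second is a quadratic polynomial against \<open>\<nabla>f\<close>, and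
  integration by parts leaves only \<open>v \<bullet> p\<close>, by unit mass and zero momentum.
\<close>

lemma wedge_pairing_tendsto:
  assumes pq: "norm p = 1" "norm q = 1" "p \<bullet> q = 0" and diag: "second_moment p q = 0"
  shows "(\<lambda>n. \<integral>w. wedge p q v w * ((w \<bullet> q) * bump (real (Suc n)) w * f w) \<partial>lborel)
     \<longlonglongrightarrow> second_moment q q * (score v \<bullet> p) + v \<bullet> p"
proof -
  have qq: "q \<bullet> q = 1" "p \<bullet> p = 1" "q \<bullet> p = 0" using pq by (auto simp: norm_eq_1 inner_commute)
  define l where "l r w = (w \<bullet> q) * ((v - w) \<bullet> r)" for r w
  define l' where "l' r w = (w \<bullet> q) *\<^sub>R (- r) + ((v - w) \<bullet> r) *\<^sub>R q" for r w
  have dl: "GDERIV (l r) w :> l' r w" for r w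
    unfolding l_def[abs_def] l'_def gderiv_def
    by (auto intro!: derivative_eq_intros simp: inner_add_right inner_diff_right inner_diff_left inner_commute algebra_simps)
  have cl': "continuous_on UNIV (l' r)" for r
    unfolding l'_def[abs_def] by (intro continuous_intros)
  define C where "C = 2 + norm v"
  have aux: "norm w * (norm v + norm w) \<le> C * (1 + (norm w)\<^sup>2)" "norm w + (norm v + norm w) \<le> C * (1 + (norm w)\<^sup>2)" for w :: "real^3"
  proof -
    have "norm v * norm w \<le> norm v * (1 + (norm w)\<^sup>2)"
      by (intro mult_left_mono norm_le_quadratic) simp
    moreover have "0 \<le> norm v * (norm w)\<^sup>2" by simp
    moreover have "C * (1 + (norm w)\<^sup>2) = 2 + norm v + 2 * (norm w)\<^sup>2 + norm v * (norm w)\<^sup>2"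
      "norm w * (norm v + norm w) = norm v * norm w + (norm w)\<^sup>2"
      "norm v * (1 + (norm w)\<^sup>2) = norm v + norm v * (norm w)\<^sup>2"
      by (simp_all add: C_def algebra_simps power2_eq_square)
    ultimately show "norm w * (norm v + norm w) \<le> C * (1 + (norm w)\<^sup>2)" "norm w + (norm v + norm w) \<le> C * (1 + (norm w)\<^sup>2)"
      using norm_le_quadratic[of w] zero_le_power2[of "norm w"] by linarith+
  qed
  have ip: "\<bar>w \<bullet> r\<bar> \<le> norm w" if "norm r = 1" for r w :: "real^3"
    using Cauchy_Schwarz_ineq2[of w r] that by simp
  have ip2: "\<bar>(v - w) \<bullet> r\<bar> \<le> norm v + norm w" if "norm r = 1" for r w :: "real^3"
    using ip[OF that, of "v - w"] norm_triangle_ineq4[of v w] by linarith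
  have l_bd: "\<bar>l r w\<bar> \<le> C * (1 + (norm w)\<^sup>2)" if "norm r = 1" for r w
  proof -
    have "\<bar>l r w\<bar> \<le> norm w * (norm v + norm w)"
      unfolding l_def abs_mult by (intro mult_mono ip ip2 pq that) auto
    then show ?thesis using aux(1)[of w] by linarith
  qed
  have l'_bd: "norm (l' r w) \<le> C * (1 + (norm w)\<^sup>2)" if "norm r = 1" for r w
  proof -
    have "norm (l' r w) \<le> norm ((w \<bullet> q) *\<^sub>R (- r)) + norm (((v - w) \<bullet> r) *\<^sub>R q)"
      unfolding l'_def by (rule norm_triangle_ineq)
    also have "\<dots> = \<bar>w \<bullet> q\<bar> + \<bar>(v - w) \<bullet> r\<bar>" using that pq by simp
    also have "\<dots> \<le> norm w + (norm v + norm w)" by (intro add_mono ip ip2 that pq)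
    finally show ?thesis using aux(2)[of w] by linarith
  qed
  have grad_lim: "(\<lambda>n. \<integral>w. l r w * bump (real (Suc n)) w * (g w \<bullet> r') \<partial>lborel) \<longlonglongrightarrow> - (\<integral>w. f w * (l' r w \<bullet> r') \<partial>lborel)"
    if "norm r = 1" for r r'
    by (rule weak_gradient_moment[OF weak_gradient dl cl' l_bd l'_bd integrable_energy]) (use that in auto)
  have int_v: "(\<integral>w. f w * ((v - w) \<bullet> p) \<partial>lborel) = v \<bullet> p"
  proof -
    have "(\<integral>w. f w * ((v - w) \<bullet> p) \<partial>lborel) = (\<integral>w. f w * (v \<bullet> p) - f w * (w \<bullet> p) \<partial>lborel)"
      by (simp add: inner_diff_left algebra_simps)
    also have "\<dots> = v \<bullet> p"
      using integrable_f integrable_inner[of p] by (simp add: integral_f integral_inner)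
    finally show ?thesis .
  qed
  have lim1: "(\<lambda>n. \<integral>w. l p w * bump (real (Suc n)) w * (g w \<bullet> q) \<partial>lborel) \<longlonglongrightarrow> - (v \<bullet> p)"
  proof -
    have e: "f w * (l' p w \<bullet> q) = f w * ((v - w) \<bullet> p)" for w
      by (simp add: l'_def inner_add_left inner_diff_left pq(3) qq)
    show ?thesis using grad_lim[OF pq(1), of q] unfolding e int_v .
  qed
  have lim2: "(\<lambda>n. \<integral>w. l q w * bump (real (Suc n)) w * (g w \<bullet> p) \<partial>lborel) \<longlonglongrightarrow> 0"
  proof -
    have e: "f w * (l' q w \<bullet> p) = 0" for w by (simp add: l'_def inner_add_left inner_diff_left qq)
    show ?thesis using grad_lim[OF pq(2), of p] unfolding e by simp
  qed
  define L where "L w = (score v \<bullet> q) * l p w - (score v \<bullet> p) * l q w" for w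
  have lm [measurable]: "l r \<in> borel_measurable borel" for r unfolding l_def[abs_def] by measurable
  have Lm [measurable]: "L \<in> borel_measurable borel" unfolding L_def[abs_def] by measurable
  have int_l: "integrable lborel (\<lambda>w. f w * l r w)" if "norm r = 1" for r
    by (rule integrable_quadratic[OF lm l_bd[OF that]])
  have int_L: "integrable lborel (\<lambda>w. f w * L w)"
  proof -
    have "integrable lborel (\<lambda>w. (score v \<bullet> q) * (f w * l p w) - (score v \<bullet> p) * (f w * l q w))"
      using int_l[OF pq(1)] int_l[OF pq(2)] by simp
    then show ?thesis by (simp add: L_def algebra_simps)
  qed
  have integral_l: "(\<integral>w. f w * l r w \<partial>lborel) = - second_moment q r" for r
  proof -
    have "(\<integral>w. f w * l r w \<partial>lborel) = (\<integral>w. (v \<bullet> r) * (f w * (w \<bullet> q)) - f w * ((w \<bullet> q) * (w \<bullet> r)) \<partial>lborel)"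
      by (simp add: l_def inner_diff_left algebra_simps)
    also have "\<dots> = - second_moment q r"
      using integrable_inner[of q] integrable_second_moment[of q r]
      by (simp add: integral_inner second_moment_def)
    finally show ?thesis .
  qed
  have "second_moment q p = 0" using diag by (simp add: second_moment_def mult.commute)
  then have integral_L: "(\<integral>w. f w * L w \<partial>lborel) = second_moment q q * (score v \<bullet> p)"
  proof -
    have "(\<integral>w. f w * L w \<partial>lborel) = (\<integral>w. (score v \<bullet> q) * (f w * l p w) - (score v \<bullet> p) * (f w * l q w) \<partial>lborel)"
      by (simp add: L_def algebra_simps)
    also have "\<dots> = (score v \<bullet> q) * (\<integral>w. f w * l p w \<partial>lborel) - (score v \<bullet> p) * (\<integral>w. f w * l q w \<partial>lborel)"
      using int_l[OF pq(1)] int_l[OF pq(2)] by simp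
    finally show ?thesis using \<open>second_moment q p = 0\<close> by (simp add: integral_l)
  qed
  have lim3: "(\<lambda>n. \<integral>w. f w * L w * bump (real (Suc n)) w \<partial>lborel) \<longlonglongrightarrow> second_moment q q * (score v \<bullet> p)"
    unfolding integral_L[symmetric]
  proof (rule integral_dominated_convergence[where w = "\<lambda>w. norm (f w * L w)"])
    show "integrable lborel (\<lambda>w. norm (f w * L w))" using int_L by (rule integrable_norm)
    show "AE w in lborel. (\<lambda>n. f w * L w * bump (real (Suc n)) w) \<longlonglongrightarrow> f w * L w"
      by (rule AE_I2) (use tendsto_mult[OF tendsto_const bump_tendsto] in fastforce)
    show "AE w in lborel. norm (f w * L w * bump (real (Suc n)) w) \<le> norm (f w * L w)" for n
      by (rule AE_I2) (use bump_range in \<open>auto simp: abs_mult abs_of_nonneg[OF bump_range(1)] intro!: mult_right_le_one_le\<close>)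
  qed auto
  have eq: "(\<integral>w. wedge p q v w * ((w \<bullet> q) * bump (real (Suc n)) w * f w) \<partial>lborel)
     = (\<integral>w. f w * L w * bump (real (Suc n)) w \<partial>lborel)
       - (\<integral>w. l p w * bump (real (Suc n)) w * (g w \<bullet> q) \<partial>lborel)
       + (\<integral>w. l q w * bump (real (Suc n)) w * (g w \<bullet> p) \<partial>lborel)" for n
  proof -
    define R where "R = real (Suc n)"
    have R: "R > 0" by (simp add: R_def)
    have ig: "integrable lborel (\<lambda>w. l r w * bump R w * (g w \<bullet> r'))" if r: "norm r = 1" for r r'
    proof (rule weak_gradient_mult_integrable(2)[OF weak_gradient])
      show "(\<lambda>w. l r w * bump R w) \<in> borel_measurable borel" by measurable
      show "l r w * bump R w = 0" if "norm w > R" for w using bump_outside(1)[OF R, of w] that by simp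
      show "\<bar>l r w * bump R w\<bar> \<le> C * (1 + R\<^sup>2)" for w
      proof (cases "norm w \<le> R")
        case True
        have "\<bar>l r w * bump R w\<bar> \<le> (C * (1 + (norm w)\<^sup>2)) * 1"
          unfolding abs_mult by (intro mult_mono l_bd[OF r]) (use bump_range[of R w] in \<open>auto simp: C_def\<close>)
        also have "\<dots> \<le> C * (1 + R\<^sup>2)"
          unfolding mult_1_right by (intro mult_left_mono add_left_mono power_mono) (use True in \<open>auto simp: C_def\<close>)
        finally show ?thesis .
      next
        case False
        then show ?thesis using bump_outside(1)[OF R, of w] by (simp add: C_def)
      qed
    qed
    have iL: "integrable lborel (\<lambda>w. f w * L w * bump R w)"
      by (rule Bochner_Integration.integrable_bound[OF int_L]; (rule AE_I2)?)
        (use bump_range in \<open>auto simp: abs_mult abs_of_nonneg[OF bump_range(1)] intro!: mult_right_le_one_le\<close>)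
    have "(\<integral>w. wedge p q v w * ((w \<bullet> q) * bump R w * f w) \<partial>lborel)
      = (\<integral>w. f w * L w * bump R w - l p w * bump R w * (g w \<bullet> q) + l q w * bump R w * (g w \<bullet> p) \<partial>lborel)"
    proof (rule integral_cong_AE)
      show "(\<lambda>w. wedge p q v w * ((w \<bullet> q) * bump R w * f w)) \<in> borel_measurable lborel"
        unfolding wedge_def[abs_def] by measurable
      show "(\<lambda>w. f w * L w * bump R w - l p w * bump R w * (g w \<bullet> q) + l q w * bump R w * (g w \<bullet> p)) \<in> borel_measurable lborel"
        by measurable
      show "AE w in lborel. wedge p q v w * ((w \<bullet> q) * bump R w * f w)
          = f w * L w * bump R w - l p w * bump R w * (g w \<bullet> q) + l q w * bump R w * (g w \<bullet> p)"
        using weak_gradient_zero_on_zero_set[OF weak_gradient nonneg]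
      proof eventually_elim
        case (elim w)
        \<comment> \<open>off a null set this also holds where \<open>f\<close> vanishes, because \<open>g\<close> does\<close>
        have g: "g w = f w *\<^sub>R score w" using elim by (cases "f w = 0") (auto simp: score_def)
        show ?case unfolding g wedge_def L_def l_def
          by (simp add: inner_diff_left algebra_simps)
      qed
    qed
    also have "\<dots> = (\<integral>w. f w * L w * bump R w \<partial>lborel)
       - (\<integral>w. l p w * bump R w * (g w \<bullet> q) \<partial>lborel) + (\<integral>w. l q w * bump R w * (g w \<bullet> p) \<partial>lborel)"
      using iL ig[OF pq(1), of q] ig[OF pq(2), of p] by simp
    finally show ?thesis unfolding R_def .
  qed
  show ?thesis unfolding eq using tendsto_add[OF tendsto_diff[OF lim3 lim1] lim2] by simp
qed

text \<open>
  Cauchy-Schwarz in \<open>L\<^sup>2(f dw)\<close>, the wedge component being divided and the polynomial \<open>w \<bullet> q\<close> multiplied by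
  \<open>|v - w|\<close> to the power \<open>3/2\<close>.  It is applied under the cutoff, whose bound is uniform in the radius.  The right-hand side may be infinite.
\<close>

lemma score_deviation_pointwise:
  assumes pq: "norm p = 1" "norm q = 1" "p \<bullet> q = 0" and diag: "second_moment p q = 0"
  shows "ennreal ((second_moment q q * (score v \<bullet> p) + v \<bullet> p)\<^sup>2)
    \<le> (\<integral>\<^sup>+w. ennreal (inverse ((norm (v - w)) ^ 3) * (wedge p q v w)\<^sup>2 * f w) \<partial>lborel)
      * (ennreal (8 * (japanese_bracket v) ^ 3) * weighted_moment 5 f)" (is "_ \<le> ?B")
proof -
  have wm [measurable]: "wedge p q v \<in> borel_measurable borel"
    unfolding wedge_def[abs_def] by measurable
  let ?I = "\<lambda>n. \<integral>w. wedge p q v w * ((w \<bullet> q) * bump (real (Suc n)) w * f w) \<partial>lborel"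
  have "ennreal ((?I n)\<^sup>2) \<le> ?B" for n
  proof -
    \<comment> \<open>the two Cauchy-Schwarz factors; at \<open>w = v\<close> both sides of the splitting vanish\<close>
    define a where "a w = sqrt (inverse ((norm (v - w)) ^ 3) * f w) * \<bar>wedge p q v w\<bar>" for w
    define b where "b w = sqrt ((norm (v - w)) ^ 3 * f w) * (\<bar>w \<bullet> q\<bar> * bump (real (Suc n)) w)" for w
    have [measurable]: "a \<in> borel_measurable borel" "b \<in> borel_measurable borel"
      unfolding a_def[abs_def] b_def[abs_def] by measurable
    have a0: "a w \<ge> 0" and b0: "b w \<ge> 0" for w
      unfolding a_def b_def by (intro mult_nonneg_nonneg real_sqrt_ge_zero bump_range nonneg; simp)+
    have ab: "\<bar>wedge p q v w * ((w \<bullet> q) * bump (real (Suc n)) w * f w)\<bar> = a w * b w" for w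
    proof (cases "v = w")
      case True
      then show ?thesis by (simp add: wedge_def a_def)
    next
      case False
      have "sqrt (inverse ((norm (v - w)) ^ 3) * f w) * sqrt ((norm (v - w)) ^ 3 * f w) = sqrt ((f w)\<^sup>2)"
      proof -
        have "inverse k * f w * (k * f w) = (f w)\<^sup>2" if "k \<noteq> 0" for k
          using that by (simp add: power2_eq_square)
        from this[of "(norm (v - w)) ^ 3"] show ?thesis
          unfolding real_sqrt_mult[symmetric] using False by simp
      qed
      also have "\<dots> = f w" using nonneg by simp
      finally have s: "sqrt (inverse ((norm (v - w)) ^ 3) * f w) * sqrt ((norm (v - w)) ^ 3 * f w) = f w" .
      have "a w * b w = (sqrt (inverse ((norm (v - w)) ^ 3) * f w) * sqrt ((norm (v - w)) ^ 3 * f w))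
          * (\<bar>wedge p q v w\<bar> * (\<bar>w \<bullet> q\<bar> * bump (real (Suc n)) w))"
        unfolding a_def b_def by (simp only: mult_ac)
      then have "a w * b w = f w * (\<bar>wedge p q v w\<bar> * (\<bar>w \<bullet> q\<bar> * bump (real (Suc n)) w))"
        unfolding s .
      then show ?thesis using nonneg[of w] bump_range[of "real (Suc n)" w]
        by (simp add: abs_mult mult_ac)
    qed
    have a2: "(ennreal (a w))\<^sup>2 = ennreal (inverse ((norm (v - w)) ^ 3) * (wedge p q v w)\<^sup>2 * f w)" for w
    proof -
      have "(a w)\<^sup>2 = inverse ((norm (v - w)) ^ 3) * (wedge p q v w)\<^sup>2 * f w"
        unfolding a_def power_mult_distrib using nonneg[of w] by simp
      then show ?thesis using a0[of w] by (simp add: ennreal_power)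
    qed
    have b2: "(ennreal (b w))\<^sup>2 \<le> ennreal (8 * (japanese_bracket v) ^ 3) * ennreal (japanese_bracket w powr 5 * f w)" for w
    proof -
      have jv: "japanese_bracket v > 0" and jw: "japanese_bracket w > 0"
        using japanese_bracket_ge(1)[of v] japanese_bracket_ge(1)[of w] by linarith+
      have "\<bar>w \<bullet> q\<bar> * bump (real (Suc n)) w \<le> norm w * 1"
        by (rule mult_mono) (use Cauchy_Schwarz_ineq2[of w q] pq bump_range in auto)
      then have "(\<bar>w \<bullet> q\<bar> * bump (real (Suc n)) w)\<^sup>2 \<le> (norm w)\<^sup>2"
        by (intro power_mono mult_nonneg_nonneg bump_range) auto
      moreover have "(b w)\<^sup>2 = f w * ((norm (v - w)) ^ 3 * (\<bar>w \<bullet> q\<bar> * bump (real (Suc n)) w)\<^sup>2)"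
        unfolding b_def power_mult_distrib[of "sqrt _"] using nonneg[of w] by (simp add: mult_ac)
      ultimately have "(b w)\<^sup>2 \<le> f w * ((norm (v - w)) ^ 3 * (norm w)\<^sup>2)"
        using nonneg[of w] by (simp add: mult_left_mono)
      also have "\<dots> \<le> f w * (8 * (japanese_bracket v) ^ 3 * (japanese_bracket w) ^ 5)"
        by (intro mult_left_mono cubic_weight_le nonneg)
      also have "\<dots> = 8 * (japanese_bracket v) ^ 3 * (japanese_bracket w powr 5 * f w)"
        using jw by (simp add: mult_ac powr_numeral)
      finally have "ennreal ((b w)\<^sup>2) \<le> ennreal (8 * (japanese_bracket v) ^ 3 * (japanese_bracket w powr 5 * f w))"
        by (rule ennreal_leI)
      then show ?thesis using b0[of w] jv nonneg[of w] by (simp add: ennreal_power ennreal_mult)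
    qed
    have "ennreal \<bar>?I n\<bar> \<le> (\<integral>\<^sup>+w. ennreal (a w) * ennreal (b w) \<partial>lborel)"
    proof (cases "integrable lborel (\<lambda>w. wedge p q v w * ((w \<bullet> q) * bump (real (Suc n)) w * f w))")
      case True
      from integral_norm_bound_ennreal[OF this] show ?thesis
        unfolding real_norm_def ab using a0 b0 by (simp add: ennreal_mult)
    next
      case False
      then show ?thesis by (simp add: not_integrable_integral_eq)
    qed
    then have "(ennreal \<bar>?I n\<bar>)\<^sup>2 \<le> (\<integral>\<^sup>+w. ennreal (a w) * ennreal (b w) \<partial>lborel)\<^sup>2"
      by (rule power_mono) simp
    also have "\<dots> \<le> (\<integral>\<^sup>+w. (ennreal (a w))\<^sup>2 \<partial>lborel) * (\<integral>\<^sup>+w. (ennreal (b w))\<^sup>2 \<partial>lborel)"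
      by (rule Cauchy_Schwarz_nn_integral) measurable
    also have "\<dots> \<le> (\<integral>\<^sup>+w. (ennreal (a w))\<^sup>2 \<partial>lborel) *
        (\<integral>\<^sup>+w. ennreal (8 * (japanese_bracket v) ^ 3) * ennreal (japanese_bracket w powr 5 * f w) \<partial>lborel)"
      by (intro mult_left_mono nn_integral_mono b2) simp
    also have "\<dots> = ?B"
      unfolding a2 weighted_moment_def by (subst nn_integral_cmult) (auto simp: mult_ac)
    finally show ?thesis by (simp add: ennreal_power)
  qed
  moreover have "(\<lambda>n. ennreal ((?I n)\<^sup>2)) \<longlonglongrightarrow> ennreal ((second_moment q q * (score v \<bullet> p) + v \<bullet> p)\<^sup>2)"
    by (intro tendsto_ennrealI tendsto_power wedge_pairing_tendsto pq diag)
  ultimately show ?thesis by (meson LIMSEQ_le_const2)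
qed

lemma nn_integral_landau_integrand:
  "(\<integral>\<^sup>+v. \<integral>\<^sup>+w. ennreal (landau_integrand f g v w) \<partial>lborel \<partial>lborel) = 2 * entropy_dissipation f g"
proof -
  have m: "(\<lambda>(v, w). ennreal (landau_integrand f g v w)) \<in> borel_measurable (lborel \<Otimes>\<^sub>M lborel)"
    unfolding landau_integrand_inner by measurable
  have "(\<integral>\<^sup>+v. \<integral>\<^sup>+w. ennreal (landau_integrand f g v w) \<partial>lborel \<partial>lborel)
    = (\<integral>\<^sup>+(v, w). ennreal (landau_integrand f g v w) \<partial>(lborel \<Otimes>\<^sub>M lborel))"
    using lborel.nn_integral_fst[OF m] by simp
  moreover have "2 * ennreal (1 / 2) = 1"
    using ennreal_mult[of 2 "1 / 2"] by simp
  ultimately show ?thesis unfolding entropy_dissipation_def mult.assoc[symmetric] by simp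
qed

text \<open>
  The weight \<open>\<langle>v\<rangle>\<^sup>-\<^sup>3\<close> cancels the factor \<open>\<langle>v\<rangle>\<^sup>3\<close> of the pointwise bound, and what is left is dominated by
  the integrand of the dissipation.
\<close>

lemma score_deviation_integrated:
  assumes pq: "norm p = 1" "norm q = 1" "p \<bullet> q = 0" and diag: "second_moment p q = 0"
  shows "(\<integral>\<^sup>+v. ennreal (f v * japanese_bracket v powr (-3) * (second_moment q q * (score v \<bullet> p) + v \<bullet> p)\<^sup>2) \<partial>lborel)
    \<le> 16 * weighted_moment 5 f * entropy_dissipation f g"
proof -
  let ?A = "\<lambda>v. \<integral>\<^sup>+w. ennreal (inverse ((norm (v - w)) ^ 3) * (wedge p q v w)\<^sup>2 * f w) \<partial>lborel"
  let ?L = "\<lambda>v. \<integral>\<^sup>+w. ennreal (landau_integrand f g v w) \<partial>lborel"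
  have wm [measurable]: "(\<lambda>w. wedge p q v w) \<in> borel_measurable borel" for v
    unfolding wedge_def[abs_def] by measurable
  have fA: "ennreal (f v) * ?A v \<le> ?L v" for v
  proof -
    have "ennreal (f v) * ?A v = (\<integral>\<^sup>+w. ennreal (f v) * ennreal (inverse ((norm (v - w)) ^ 3) * (wedge p q v w)\<^sup>2 * f w) \<partial>lborel)"
      by (rule nn_integral_cmult[symmetric]) measurable
    also have "\<dots> \<le> ?L v"
    proof (rule nn_integral_mono)
      fix w
      have "f v * (inverse ((norm (v - w)) ^ 3) * (wedge p q v w)\<^sup>2 * f w) \<le> landau_integrand f g v w"
        using landau_integrand_ge[OF pq nonneg, where g=g and v=v and w=w] unfolding wedge_def score_def by (simp add: mult_ac)
      then show "ennreal (f v) * ennreal (inverse ((norm (v - w)) ^ 3) * (wedge p q v w)\<^sup>2 * f w) \<le> ennreal (landau_integrand f g v w)"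
        using nonneg by (subst ennreal_mult[symmetric]) (auto intro: ennreal_leI)
    qed
    finally show ?thesis .
  qed
  have "ennreal (f v * japanese_bracket v powr (-3) * (second_moment q q * (score v \<bullet> p) + v \<bullet> p)\<^sup>2)
     \<le> (8 * weighted_moment 5 f) * ?L v" for v
  proof -
    define j where "j = japanese_bracket v"
    have j: "j > 0" using japanese_bracket_ge(1)[of v] unfolding j_def by linarith
    have jp: "j powr (-3) = inverse (j ^ 3)" using j by (simp add: powr_minus powr_numeral)
    have "ennreal (f v * j powr (-3) * (second_moment q q * (score v \<bullet> p) + v \<bullet> p)\<^sup>2)
      = ennreal (f v) * ennreal (j powr (-3)) * ennreal ((second_moment q q * (score v \<bullet> p) + v \<bullet> p)\<^sup>2)"
      using nonneg[of v] by (simp add: ennreal_mult)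
    also have "\<dots> \<le> ennreal (f v) * ennreal (j powr (-3)) * (?A v * (ennreal (8 * j ^ 3) * weighted_moment 5 f))"
      unfolding j_def by (intro mult_left_mono score_deviation_pointwise pq diag) simp
    also have "\<dots> = (ennreal (j powr (-3)) * ennreal (8 * j ^ 3)) * weighted_moment 5 f * (ennreal (f v) * ?A v)"
      by (simp add: mult_ac)
    also have "ennreal (j powr (-3)) * ennreal (8 * j ^ 3) = 8"
    proof -
      have "ennreal (j powr (-3)) * ennreal (8 * j ^ 3) = ennreal (j powr (-3) * (8 * j ^ 3))"
        using j by (subst ennreal_mult[symmetric]) auto
      also have "j powr (-3) * (8 * j ^ 3) = 8" using j by (simp add: jp)
      finally show ?thesis by simp
    qed
    also have "8 * weighted_moment 5 f * (ennreal (f v) * ?A v) \<le> 8 * weighted_moment 5 f * ?L v"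
      by (intro mult_left_mono fA) simp
    finally show ?thesis unfolding j_def .
  qed
  then have "(\<integral>\<^sup>+v. ennreal (f v * japanese_bracket v powr (-3) * (second_moment q q * (score v \<bullet> p) + v \<bullet> p)\<^sup>2) \<partial>lborel)
    \<le> (\<integral>\<^sup>+v. (8 * weighted_moment 5 f) * ?L v \<partial>lborel)"
    by (intro nn_integral_mono)
  also have "\<dots> = (8 * weighted_moment 5 f) * (\<integral>\<^sup>+v. ?L v \<partial>lborel)"
  proof (rule nn_integral_cmult)
    have "(\<lambda>(v, w). ennreal (landau_integrand f g v w)) \<in> borel_measurable (lborel \<Otimes>\<^sub>M lborel)"
      unfolding landau_integrand_inner by measurable
    from lborel.borel_measurable_nn_integral_fst[OF this]
    show "?L \<in> borel_measurable lborel" by simp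
  qed
  also have "\<dots> = 8 * weighted_moment 5 f * (2 * entropy_dissipation f g)"
    unfolding nn_integral_landau_integrand ..
  also have "\<dots> = (8 * 2) * weighted_moment 5 f * entropy_dissipation f g" by (simp only: mult_ac)
  also have "8 * 2 = (16 :: ennreal)" by simp
  finally show ?thesis .
qed

end

section \<open>Diagonalizing the second moments\<close>

text \<open>
  First-order condition at a maximizer of the quadratic form on the unit sphere of \<open>V\<close>: comparing \<open>e\<close>
  with \<open>e + t x\<close> gives \<open>2 t B(e, x) \<le> t\<^sup>2 \<kappa>\<close> for all \<open>t\<close>, which forces \<open>B(e, x) = 0\<close>.
\<close>

lemma bilinear_maximizer_orthogonal:
  fixes B :: "'a::euclidean_space \<Rightarrow> 'a \<Rightarrow> real"
  assumes B: "bilinear B" and sym: "\<And>x y. B x y = B y x"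
    and V: "subspace V" "e \<in> V" and e: "norm e = 1"
    and max: "\<And>y. y \<in> V \<Longrightarrow> norm y = 1 \<Longrightarrow> B y y \<le> B e e"
    and x: "x \<in> V" "x \<bullet> e = 0"
  shows "B e x = 0"
proof -
  note bl = bilinear_ladd[OF B] bilinear_radd[OF B] bilinear_lmul[OF B] bilinear_rmul[OF B]
  have hom: "B y y \<le> B e e * (norm y)\<^sup>2" if "y \<in> V" for y
  proof (cases "y = 0")
    case False
    have "B (y /\<^sub>R norm y) (y /\<^sub>R norm y) \<le> B e e"
      by (rule max) (use False that V(1) in \<open>auto simp: subspace_scale\<close>)
    then have "B y y / (norm y)\<^sup>2 \<le> B e e" by (simp add: bl power2_eq_square field_simps)
    then show ?thesis using False by (simp add: divide_le_eq)
  qed (simp add: bilinear_lzero[OF B])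
  \<comment> \<open>the second-order coefficient of \<open>B(y, y) - B(e, e) |y|\<^sup>2\<close> along \<open>y = e + t x\<close>, with sign reversed\<close>
  define \<kappa> where "\<kappa> = B e e * (norm x)\<^sup>2 - B x x"
  have key: "2 * t * B e x \<le> t\<^sup>2 * \<kappa>" for t
  proof -
    have "(norm (e + t *\<^sub>R x))\<^sup>2 = 1 + t\<^sup>2 * (norm x)\<^sup>2"
      using e x(2) unfolding power2_norm_eq_inner
      by (simp add: inner_add_left inner_add_right inner_commute power2_eq_square norm_eq_1)
    moreover have "B (e + t *\<^sub>R x) (e + t *\<^sub>R x) = B e e + 2 * t * B e x + t\<^sup>2 * B x x"
      by (simp add: bl sym[of x e] power2_eq_square algebra_simps)
    moreover have "e + t *\<^sub>R x \<in> V" using V x(1) by (simp add: subspace_add subspace_scale)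
    ultimately show ?thesis using hom[of "e + t *\<^sub>R x"] by (simp add: \<kappa>_def algebra_simps)
  qed
  define K where "K = \<bar>\<kappa>\<bar> + 1"
  have K: "K > 0" "\<kappa> \<le> K" by (auto simp: K_def)
  define \<beta> where "\<beta> = B e x"
  have "2 * (\<beta> / K) * \<beta> \<le> (\<beta> / K)\<^sup>2 * \<kappa>" using key[of "\<beta> / K"] by (simp add: \<beta>_def)
  also have "\<dots> \<le> (\<beta> / K)\<^sup>2 * K" by (intro mult_left_mono K) simp
  finally have "2 * \<beta>\<^sup>2 / K \<le> \<beta>\<^sup>2 / K" using K(1) by (simp add: power2_eq_square field_simps)
  then have "\<beta>\<^sup>2 \<le> 0" using K(1) by (simp add: divide_le_cancel)
  then show ?thesis by (simp add: \<beta>_def)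
qed

text \<open>
  The spectral theorem in the form needed here, by successive maximization on the orthogonal complement
  of the vectors already chosen.  The last conjunct carries the induction: it says that \<open>B\<close> pairs
  the chosen vectors trivially with that complement, so every later vector is automatically conjugate
  to the earlier ones.
\<close>

lemma symmetric_bilinear_orthonormal_set:
  fixes B :: "'a::euclidean_space \<Rightarrow> 'a \<Rightarrow> real"
  assumes B: "bilinear B" and sym: "\<And>x y. B x y = B y x" and "k \<le> DIM('a)"
  shows "\<exists>S. finite S \<and> card S = k \<and> pairwise orthogonal S \<and> (\<forall>p\<in>S. norm p = 1) \<and>
     (\<forall>p\<in>S. \<forall>q\<in>S. p \<noteq> q \<longrightarrow> B p q = 0) \<and>
     (\<forall>p\<in>S. \<forall>x. (\<forall>q\<in>S. x \<bullet> q = 0) \<longrightarrow> B p x = 0)"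
  using \<open>k \<le> DIM('a)\<close>
proof (induction k)
  case 0
  show ?case by (rule exI[of _ "{}"]) simp
next
  case (Suc k)
  then obtain S where S: "finite S" "card S = k" "pairwise orthogonal S" "\<And>p. p \<in> S \<Longrightarrow> norm p = 1"
    "\<And>p q. p \<in> S \<Longrightarrow> q \<in> S \<Longrightarrow> p \<noteq> q \<Longrightarrow> B p q = 0"
    "\<And>p x. p \<in> S \<Longrightarrow> (\<And>q. q \<in> S \<Longrightarrow> x \<bullet> q = 0) \<Longrightarrow> B p x = 0"
    by (metis Suc_leD)
  define V where "V = {x. \<forall>q\<in>S. x \<bullet> q = 0}"
  have subV: "subspace V" unfolding V_def subspace_def by (auto simp: inner_add_left)
  have "dim S < DIM('a)" using dim_le_card'[OF S(1)] S(2) Suc.prems by simp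
  then obtain y where y: "y \<noteq> 0" "\<And>z. z \<in> span S \<Longrightarrow> orthogonal y z"
    using orthogonal_to_subspace_exists by blast
  have "y /\<^sub>R norm y \<in> V \<inter> sphere 0 1"
    using y span_base unfolding V_def orthogonal_def by auto
  then have "V \<inter> sphere 0 1 \<noteq> {}" by blast
  moreover have "compact (V \<inter> sphere 0 1)"
    by (rule closed_Int_compact) (use closed_subspace[OF subV] in auto)
  moreover have "continuous_on (V \<inter> sphere 0 1) (\<lambda>x. B x x)"
    by (rule bilinear_continuous_on_compose[OF continuous_on_id continuous_on_id B])
  ultimately obtain e where e0: "e \<in> V \<inter> sphere 0 1" "\<forall>y\<in>V \<inter> sphere 0 1. B y y \<le> B e e"
    using continuous_attains_sup[of "V \<inter> sphere 0 1" "\<lambda>x. B x x"] by blast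
  then have e: "e \<in> V" "norm e = 1" "\<And>y. y \<in> V \<Longrightarrow> norm y = 1 \<Longrightarrow> B y y \<le> B e e" by auto
  have eS: "e \<notin> S" using e(1,2) by (auto simp: V_def)
  have orth: "e \<bullet> q = 0" if "q \<in> S" for q using e(1) that by (simp add: V_def)
  show ?case
  proof (intro exI[of _ "insert e S"] conjI ballI allI impI)
    show "card (insert e S) = Suc k" using S(1,2) eS by simp
    show "pairwise orthogonal (insert e S)"
      using S(3) orth by (auto simp: pairwise_insert orthogonal_def inner_commute)
    show "B p q = 0" if "p \<in> insert e S" "q \<in> insert e S" "p \<noteq> q" for p q
      using that S(5,6) orth sym by (metis insert_iff)
    show "B p x = 0" if "p \<in> insert e S" "\<forall>q\<in>insert e S. x \<bullet> q = 0" for p x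
    proof (cases "p = e")
      case True
      have "B e x = 0"
        by (rule bilinear_maximizer_orthogonal[OF B sym subV e]) (use that in \<open>auto simp: V_def\<close>)
      then show ?thesis using True by simp
    qed (use that S(6) in auto)
  qed (use S(1,4) e(2) in auto)
qed

lemma symmetric_bilinear_orthonormal_basis:
  fixes B :: "'a::euclidean_space \<Rightarrow> 'a \<Rightarrow> real"
  assumes "bilinear B" "\<And>x y. B x y = B y x"
  obtains E where "finite E" "card E = DIM('a)" "pairwise orthogonal E" "\<And>p. p \<in> E \<Longrightarrow> norm p = 1"
    "\<And>p q. p \<in> E \<Longrightarrow> q \<in> E \<Longrightarrow> p \<noteq> q \<Longrightarrow> B p q = 0"
  using symmetric_bilinear_orthonormal_set[OF assms order_refl] by blast

lemma norm_squared_orthonormal_basis: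
  fixes x :: "'a::euclidean_space"
  assumes E: "finite E" "card E = DIM('a)" "pairwise orthogonal E" "\<And>p. p \<in> E \<Longrightarrow> norm p = 1"
  shows "(norm x)\<^sup>2 = (\<Sum>p\<in>E. (x \<bullet> p)\<^sup>2)"
proof -
  have "0 \<notin> E" using E(4) by fastforce
  then have "independent E" using E(3) pairwise_orthogonal_independent by blast
  then have "span E = UNIV"
    using E(2) card_ge_dim_independent[of E UNIV] by auto
  then have "(\<Sum>p\<in>E. (x \<bullet> p) *\<^sub>R p) = x"
    by (intro orthonormal_basis_expand E) auto
  then have "x \<bullet> x = (\<Sum>p\<in>E. (x \<bullet> p) *\<^sub>R p) \<bullet> x" by simp
  also have "\<dots> = (\<Sum>p\<in>E. (x \<bullet> p)\<^sup>2)"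
    unfolding inner_sum_left by (simp add: inner_commute power2_eq_square)
  finally show ?thesis by (simp add: power2_norm_eq_inner)
qed

section \<open>The entropy bound keeps the density away from planes\<close>

lemma integrable_gaussian: "integrable lborel (\<lambda>v::'a::euclidean_space. exp (- (norm v)\<^sup>2 / 2))"
proof (rule integrableI_bounded)
  have one: "(\<integral>\<^sup>+x. ennreal (exp (- x\<^sup>2 / 2)) \<partial>(lborel :: real measure)) < \<infinity>"
  proof -
    have "integrable lborel (\<lambda>x. sqrt (2 * pi) * std_normal_density x)" by simp
    then have "integrable lborel (\<lambda>x::real. exp (- x\<^sup>2 / 2))"
      by (simp add: std_normal_density_def)
    then show ?thesis by (simp add: integrable_iff_bounded)
  qed
  have "(\<integral>\<^sup>+v. ennreal (norm (exp (- (norm v)\<^sup>2 / 2))) \<partial>(lborel :: 'a measure))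
    = (\<integral>\<^sup>+v. (\<Prod>b\<in>Basis. ennreal (exp (- (v \<bullet> b)\<^sup>2 / 2))) \<partial>(lborel :: 'a measure))"
  proof (rule nn_integral_cong)
    fix v :: 'a
    have "- (norm v)\<^sup>2 / 2 = (\<Sum>b\<in>Basis. - (v \<bullet> b)\<^sup>2 / 2)"
      by (simp add: norm_squared_orthonormal_basis[of Basis v] pairwise_def orthogonal_def inner_not_same_Basis
          sum_negf sum_divide_distrib)
    then have "exp (- (norm v)\<^sup>2 / 2) = (\<Prod>b\<in>Basis. exp (- (v \<bullet> b)\<^sup>2 / 2))"
      by (simp only: exp_sum[OF finite_Basis])
    moreover have "ennreal (norm (exp (- (norm v)\<^sup>2 / 2))) = ennreal (exp (- (norm v)\<^sup>2 / 2))" by simp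
    ultimately show "ennreal (norm (exp (- (norm v)\<^sup>2 / 2))) = (\<Prod>b\<in>Basis. ennreal (exp (- (v \<bullet> b)\<^sup>2 / 2)))"
      by (simp add: prod_ennreal)
  qed
  also have "\<dots> = (\<Prod>b\<in>(Basis::'a set). \<integral>\<^sup>+x. ennreal (exp (- x\<^sup>2 / 2)) \<partial>(lborel :: real measure))"
    by (rule nn_integral_lborel_prod) auto
  also have "\<dots> < \<infinity>" using one by (simp add: power_less_top_ennreal)
  finally show "(\<integral>\<^sup>+v. ennreal (norm (exp (- (norm v)\<^sup>2 / 2))) \<partial>(lborel :: 'a measure)) < \<infinity>" .
qed simp

text \<open>
  The Young inequality of the conjugate pair \<open>s ln s - s\<close> and \<open>exp h\<close>, from \<open>1 + t \<le> exp t\<close> at \<open>t = h - ln s\<close>.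
\<close>

lemma young_entropy:
  fixes s h :: real
  assumes "s \<ge> 0"
  shows "s * h \<le> s * ln s - s + exp h"
proof (cases "s = 0")
  case False
  then have s: "s > 0" using assms by simp
  have "s * (1 + (h - ln s)) \<le> s * exp (h - ln s)"
    by (intro mult_left_mono exp_ge_add_one_self assms)
  also have "\<dots> = exp h" using s by (simp add: exp_diff)
  finally show ?thesis by (simp add: algebra_simps)
qed simp

text \<open>
  An orthogonal map carries the slab into a coordinate box with sides \<open>2 \<delta>\<close>, \<open>2 R\<close> and \<open>2 R\<close>.
\<close>

lemma measure_slab_le:
  fixes e :: "real^3"
  assumes e: "norm e = 1" and "\<delta> > 0" "R > 0"
  defines "A \<equiv> {v. \<bar>v \<bullet> e\<bar> \<le> \<delta> \<and> norm v \<le> R}"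
  shows "A \<in> sets borel" "emeasure lborel A < \<infinity>" "measure lborel A \<le> 8 * \<delta> * R\<^sup>2"
proof -
  have "closed ({v. \<bar>v \<bullet> e\<bar> \<le> \<delta>} \<inter> {v. norm v \<le> R})"
    by (intro closed_Int closed_Collect_le continuous_intros)
  moreover have A_eq: "A = {v. \<bar>v \<bullet> e\<bar> \<le> \<delta>} \<inter> {v. norm v \<le> R}" unfolding A_def by auto
  ultimately have clA: "closed A" by simp
  then show As: "A \<in> sets borel" by simp
  have "bounded A" by (rule bounded_subset[of "cball 0 R"]) (auto simp: A_def)
  then show "emeasure lborel A < \<infinity>" using emeasure_bounded_finite by blast
  have "norm (axis 1 1 :: real^3) = norm e" using e by (simp add: norm_axis_1)
  then obtain T :: "real^3 \<Rightarrow> real^3" where T: "orthogonal_transformation T" "T (axis 1 1) = e"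
    by (rule orthogonal_transformation_exists)
  define b :: "real^3" where "b = (\<chi> i. if i = 1 then \<delta> else R)"
  have sub: "A \<subseteq> T ` cbox (- b) b"
  proof
    fix v assume v: "v \<in> A"
    obtain u where u: "v = T u" using orthogonal_transformation_surj[OF T(1)] by blast
    have nu: "norm u \<le> R" using v u T(1) by (simp add: A_def orthogonal_transformation)
    have "T u \<bullet> T (axis 1 1) = u \<bullet> axis 1 1" using T(1) unfolding orthogonal_transformation_def by blast
    then have "\<bar>u $ 1\<bar> \<le> \<delta>" using v u T(2) by (simp add: A_def inner_axis)
    moreover have "\<bar>u $ i\<bar> \<le> R" for i using component_le_norm_cart[of u i] nu by linarith
    ultimately have "\<bar>u $ i\<bar> \<le> b $ i" for i unfolding b_def by simp
    then have "u \<in> cbox (- b) b" unfolding mem_box_cart by (simp add: abs_le_iff minus_le_iff)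
    then show "v \<in> T ` cbox (- b) b" using u by blast
  qed
  have lm: "T ` cbox (- b) b \<in> lmeasurable" by (rule measurable_orthogonal_image[OF T(1)]) simp
  have "measure lborel A = measure lebesgue A" using As by (simp add: measure_completion)
  also have "\<dots> \<le> measure lebesgue (T ` cbox (- b) b)"
    by (rule measure_mono_fmeasurable[OF sub _ lm]) (use As in auto)
  also have "\<dots> = measure lebesgue (cbox (- b) b)" by (rule measure_orthogonal_image[OF T(1)]) simp
  also have "\<dots> = measure lborel (cbox (- b) b)" by (simp add: measure_completion)
  also have "\<dots> = (\<Prod>i\<in>UNIV. b $ i - (- b) $ i)"
  proof (rule content_cbox_cart)
    have "(0::real^3) \<in> cbox (- b) b" using \<open>\<delta> > 0\<close> \<open>R > 0\<close> by (simp add: mem_box_cart b_def)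
    then show "cbox (- b) b \<noteq> {}" by blast
  qed
  also have "\<dots> = 8 * \<delta> * R\<^sup>2"
    unfolding UNIV_3 by (simp add: b_def power2_eq_square)
  finally show "measure lborel A \<le> 8 * \<delta> * R\<^sup>2" .
qed

text \<open>
  The Young inequality with \<open>h = \<mu> 1\<^sub>A - |v|\<^sup>2 / 2\<close>.  The Gaussian term makes \<open>exp h\<close> integrable over the
  whole space, and it costs only the known energy; this replaces a separate estimate of the negative
  part of \<open>f ln f\<close>.
\<close>

lemma (in normalized_density) entropy_bounds_mass:
  assumes H: "entropy_le f Hbar" and A: "A \<in> sets borel" "emeasure lborel A < \<infinity>" and "\<mu> \<ge> 0"
  shows "\<mu> * (\<integral>v. f v * indicator A v \<partial>lborel)
    \<le> Hbar + 1 / 2 + (\<integral>v. exp (- (norm v)\<^sup>2 / 2) \<partial>(lborel :: (real^3) measure)) + exp \<mu> * measure lborel A"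
proof -
  have [measurable]: "A \<in> sets borel" by fact
  have ifA: "integrable lborel (\<lambda>v. f v * indicator A v)"
    by (rule integrable_quadratic[where C = 1]) (auto simp: indicator_def)
  have iA: "integrable lborel (indicator A :: real^3 \<Rightarrow> real)"
    using A by (intro integrable_real_indicator) auto
  have ie: "integrable lborel (\<lambda>v. f v * (norm v)\<^sup>2)" "(\<integral>v. f v * (norm v)\<^sup>2 \<partial>lborel) = 3"
    using energy by (auto simp: has_bochner_integral_iff)
  have iH: "integrable lborel (\<lambda>v. f v * ln (f v))" "(\<integral>v. f v * ln (f v) \<partial>lborel) \<le> Hbar"
    using H unfolding entropy_le_def by auto
  note ig = integrable_gaussian[where 'a = "real^3"]
  have pt: "\<mu> * (f v * indicator A v) - (1 / 2) * (f v * (norm v)\<^sup>2)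
      \<le> f v * ln (f v) - f v + (exp (- (norm v)\<^sup>2 / 2) + exp \<mu> * indicator A v)" for v
  proof -
    let ?h = "\<mu> * indicator A v - (norm v)\<^sup>2 / 2"
    have "exp ?h \<le> exp (- (norm v)\<^sup>2 / 2) + exp \<mu> * indicator A v"
    proof (cases "v \<in> A")
      case True
      have "exp ?h \<le> exp \<mu>" using True by simp
      then show ?thesis using True exp_ge_zero[of "- (norm v)\<^sup>2 / 2"] by (simp only: indicator_simps mult_1_right)
    qed simp
    moreover have "\<mu> * (f v * indicator A v) - (1 / 2) * (f v * (norm v)\<^sup>2) = f v * ?h" by (simp add: algebra_simps)
    ultimately show ?thesis using young_entropy[OF nonneg, of v ?h] by linarith
  qed
  have "(\<integral>v. \<mu> * (f v * indicator A v) - (1 / 2) * (f v * (norm v)\<^sup>2) \<partial>lborel)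
    \<le> (\<integral>v. f v * ln (f v) - f v + (exp (- (norm v)\<^sup>2 / 2) + exp \<mu> * indicator A v) \<partial>lborel)"
  proof (rule integral_mono)
    show "integrable lborel (\<lambda>v. \<mu> * (f v * indicator A v) - (1 / 2) * (f v * (norm v)\<^sup>2))"
      by (intro Bochner_Integration.integrable_diff integrable_mult_right ifA ie)
    show "integrable lborel (\<lambda>v. f v * ln (f v) - f v + (exp (- (norm v)\<^sup>2 / 2) + exp \<mu> * indicator A v))"
      by (intro Bochner_Integration.integrable_add Bochner_Integration.integrable_diff integrable_mult_right iA iH integrable_f ig)
  qed (rule pt)
  moreover have "(\<integral>v. \<mu> * (f v * indicator A v) - (1 / 2) * (f v * (norm v)\<^sup>2) \<partial>lborel)
    = \<mu> * (\<integral>v. f v * indicator A v \<partial>lborel) - (1 / 2) * 3"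
    by (subst Bochner_Integration.integral_diff)
      (auto simp only: integrable_mult_right ifA ie integral_mult_right_zero)
  moreover have "(\<integral>v. f v * ln (f v) - f v + (exp (- (norm v)\<^sup>2 / 2) + exp \<mu> * indicator A v) \<partial>lborel)
    = (\<integral>v. f v * ln (f v) \<partial>lborel) - 1 + ((\<integral>v. exp (- (norm v)\<^sup>2 / 2) \<partial>(lborel :: (real^3) measure)) + exp \<mu> * measure lborel A)"
  proof -
    have "(\<integral>v. f v * ln (f v) - f v + (exp (- (norm v)\<^sup>2 / 2) + exp \<mu> * indicator A v) \<partial>lborel)
      = (\<integral>v. f v * ln (f v) - f v \<partial>lborel) + (\<integral>v. exp (- (norm v)\<^sup>2 / 2) + exp \<mu> * indicator A v \<partial>lborel)"
      by (intro Bochner_Integration.integral_add Bochner_Integration.integrable_add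
        Bochner_Integration.integrable_diff integrable_mult_right iA iH integrable_f ig)
    also have "(\<integral>v. f v * ln (f v) - f v \<partial>lborel) = (\<integral>v. f v * ln (f v) \<partial>lborel) - 1"
      using Bochner_Integration.integral_diff[OF iH(1) integrable_f] integral_f by simp
    also have "(\<integral>v. exp (- (norm v)\<^sup>2 / 2) + exp \<mu> * indicator A v \<partial>lborel)
        = (\<integral>v. exp (- (norm v)\<^sup>2 / 2) \<partial>(lborel :: (real^3) measure)) + exp \<mu> * measure lborel A"
      using Bochner_Integration.integral_add[OF ig integrable_mult_right[OF iA, of "exp \<mu>"]] by simp
    finally show ?thesis .
  qed
  ultimately show ?thesis using iH(2) by linarith
qed

text \<open>
  With \<open>\<mu>\<close> this large and \<open>\<delta> = exp (- \<mu>) / 72\<close>, a slab of half-width \<open>\<delta>\<close> inside the ball of radius \<open>3\<close>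
  carries mass at most \<open>1/4\<close> of any normalized density with entropy at most \<open>Hbar\<close>.  The factor
  \<open>1/64 = 4\<^sup>-\<^sup>3\<close> bounds the weight on that ball from below, and
  \<open>5/12 = 1 - 1/4 - 1/3\<close> is the mass left after removing the slab and the exterior of the ball.
\<close>

definition nondegeneracy :: "real \<Rightarrow> real"
  where "nondegeneracy Hbar =
    (let G = (\<integral>v. exp (- (norm v)\<^sup>2 / 2) \<partial>(lborel :: (real^3) measure));
         \<mu> = 4 * (\<bar>Hbar\<bar> + G + 2)
     in (exp (- \<mu>) / 72)\<^sup>2 / 64 * (5 / 12))"

lemma nondegeneracy_pos: "nondegeneracy Hbar > 0"
  by (simp add: nondegeneracy_def Let_def)

context normalized_density
begin

lemma integrable_weighted:
  assumes "norm e = 1"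
  shows "integrable lborel (\<lambda>v. f v * (japanese_bracket v powr (-3) * (v \<bullet> e)\<^sup>2))"
    and "japanese_bracket v powr (-3) * (v \<bullet> e)\<^sup>2 \<le> 1"
    and "japanese_bracket v powr (-3) * (v \<bullet> e)\<^sup>2 \<le> (v \<bullet> e)\<^sup>2"
proof -
  have j: "japanese_bracket u powr (-3) = inverse (japanese_bracket u ^ 3)" "japanese_bracket u > 0" for u :: "real^3"
  proof -
    show "japanese_bracket u > 0" using japanese_bracket_ge(1)[of u] by linarith
    then show "japanese_bracket u powr (-3) = inverse (japanese_bracket u ^ 3)"
      by (simp add: powr_minus powr_numeral)
  qed
  have le1: "japanese_bracket u powr (-3) * (u \<bullet> e)\<^sup>2 \<le> 1" for u
  proof -
    have "(u \<bullet> e)\<^sup>2 \<le> (norm u)\<^sup>2"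
      using Cauchy_Schwarz_ineq2[of u e] assms by (metis abs_ge_zero mult.right_neutral power2_abs power_mono)
    also have "\<dots> \<le> japanese_bracket u ^ 2" by (rule japanese_bracket_ge)
    also have "\<dots> \<le> japanese_bracket u ^ 3" by (rule power_increasing) (use japanese_bracket_ge in auto)
    finally show ?thesis unfolding j(1) using j(2)[of u] by (simp add: field_simps)
  qed
  then show "japanese_bracket v powr (-3) * (v \<bullet> e)\<^sup>2 \<le> 1" .
  have "japanese_bracket v powr (-3) \<le> 1"
    unfolding j(1) by (rule inverse_le_1_iff[THEN iffD2]) (use japanese_bracket_ge(1)[of v] in auto)
  then show "japanese_bracket v powr (-3) * (v \<bullet> e)\<^sup>2 \<le> (v \<bullet> e)\<^sup>2"
    by (intro mult_left_le_one_le) auto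
  show "integrable lborel (\<lambda>v. f v * (japanese_bracket v powr (-3) * (v \<bullet> e)\<^sup>2))"
  proof (rule integrable_quadratic[where C = 1])
    fix v :: "real^3"
    show "\<bar>japanese_bracket v powr (-3) * (v \<bullet> e)\<^sup>2\<bar> \<le> 1 * (1 + (norm v)\<^sup>2)"
      using order_trans[OF le1[of v], of "1 + (norm v)\<^sup>2"] by (simp add: abs_mult)
  qed measurable
qed

text \<open>
  Off a thin slab around the plane orthogonal to \<open>e\<close> and within the ball of radius \<open>3\<close>, the integrand is
  at least a constant times \<open>f\<close>.  The slab has little mass by the entropy bound, and the exterior of
  the ball carries at most \<open>3 / 9\<close> by the energy.
\<close>

lemma nondegeneracy_le:
  assumes H: "entropy_le f Hbar" and e: "norm e = 1"
  shows "nondegeneracy Hbar \<le> (\<integral>v. f v * (japanese_bracket v powr (-3) * (v \<bullet> e)\<^sup>2) \<partial>lborel)"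
proof -
  define G where "G = (\<integral>v. exp (- (norm v)\<^sup>2 / 2) \<partial>(lborel :: (real^3) measure))"
  have G: "G \<ge> 0" unfolding G_def by (rule integral_nonneg_AE) auto
  define \<mu> where "\<mu> = 4 * (\<bar>Hbar\<bar> + G + 2)"
  have \<mu>: "\<mu> > 0" using G by (simp add: \<mu>_def)
  define \<delta> where "\<delta> = exp (- \<mu>) / 72"
  have \<delta>: "\<delta> > 0" by (simp add: \<delta>_def)
  define A where "A = {v::real^3. \<bar>v \<bullet> e\<bar> \<le> \<delta> \<and> norm v \<le> 3}"
  have A: "A \<in> sets borel" "emeasure lborel A < \<infinity>" "measure lborel A \<le> 8 * \<delta> * 3\<^sup>2"
    unfolding A_def by (rule measure_slab_le[OF e \<delta>]; simp)+
  have [measurable]: "A \<in> sets borel" by fact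
  have "exp \<mu> * measure lborel A \<le> exp \<mu> * (8 * \<delta> * 3\<^sup>2)" by (intro mult_left_mono A) simp
  also have "\<dots> = 1" by (simp add: \<delta>_def exp_minus)
  finally have "\<mu> * (\<integral>v. f v * indicator A v \<partial>lborel) \<le> Hbar + 1 / 2 + G + 1"
    using entropy_bounds_mass[OF H A(1,2), of \<mu>] \<mu> unfolding G_def by linarith
  also have "\<dots> \<le> \<mu> * (1 / 4)" unfolding \<mu>_def by simp
  finally have mA: "(\<integral>v. f v * indicator A v \<partial>lborel) \<le> 1 / 4"
    using \<mu> by (simp add: mult_le_cancel_left_pos)
  have ifA: "integrable lborel (\<lambda>v. f v * indicator A v)"
    by (rule integrable_quadratic[where C = 1]) (auto simp: indicator_def)
  have ie: "integrable lborel (\<lambda>v. f v * (norm v)\<^sup>2)" "(\<integral>v. f v * (norm v)\<^sup>2 \<partial>lborel) = 3"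
    using energy by (auto simp: has_bochner_integral_iff)
  define c where "c = \<delta>\<^sup>2 / 64"
  have c: "c > 0" using \<delta> by (simp add: c_def)
  \<comment> \<open>nonpositive on the slab and outside the ball, and at most \<open>c f\<close> elsewhere\<close>
  let ?lower = "\<lambda>v. c * (f v - f v * indicator A v - (1 / 9) * (f v * (norm v)\<^sup>2))"
  have pt: "?lower v \<le> f v * (japanese_bracket v powr (-3) * (v \<bullet> e)\<^sup>2)" for v
  proof -
    have rhs0: "0 \<le> f v * (japanese_bracket v powr (-3) * (v \<bullet> e)\<^sup>2)"
      by (intro mult_nonneg_nonneg nonneg) auto
    have lower: "?lower v = f v * (c * (1 - indicator A v - (norm v)\<^sup>2 / 9))" by (simp add: algebra_simps)
    consider "v \<in> A \<or> norm v > 3" | "v \<notin> A" "norm v \<le> 3" by linarith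
    then show ?thesis
    proof cases
      case 1
      have "1 - indicator A v - (norm v)\<^sup>2 / 9 \<le> (0::real)"
      proof (cases "v \<in> A")
        case False
        then have "3\<^sup>2 \<le> (norm v)\<^sup>2" using 1 by (intro power_mono) auto
        then show ?thesis using False by simp
      qed simp
      then have "c * (1 - indicator A v - (norm v)\<^sup>2 / 9) \<le> 0" using c by (simp add: mult_le_0_iff)
      then have "?lower v \<le> 0" unfolding lower using nonneg[of v] by (rule mult_nonneg_nonpos[rotated])
      then show ?thesis using rhs0 by linarith
    next
      case 2
      have "\<delta>\<^sup>2 \<le> \<bar>v \<bullet> e\<bar>\<^sup>2" using 2 \<delta> by (intro power_mono) (auto simp: A_def)
      then have ve: "\<delta>\<^sup>2 \<le> (v \<bullet> e)\<^sup>2" by simp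
      have "(norm v)\<^sup>2 \<le> 3\<^sup>2" using 2 by (intro power_mono) auto
      then have "japanese_bracket v \<le> 4" unfolding japanese_bracket_def by (intro real_le_lsqrt) auto
      then have "japanese_bracket v ^ 3 \<le> 4 ^ 3" using japanese_bracket_ge(1)[of v] by (intro power_mono) auto
      moreover have "japanese_bracket v > 0" using japanese_bracket_ge(1)[of v] by linarith
      ultimately have "1 / 64 \<le> japanese_bracket v powr (-3)"
        by (simp add: powr_minus powr_numeral field_simps)
      then have "(1 / 64) * \<delta>\<^sup>2 \<le> japanese_bracket v powr (-3) * (v \<bullet> e)\<^sup>2"
        by (intro mult_mono ve) auto
      moreover have "c * (1 - indicator A v - (norm v)\<^sup>2 / 9) \<le> c * 1"
        by (rule mult_left_mono) (use c 2(1) in simp_all)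
      ultimately have "c * (1 - indicator A v - (norm v)\<^sup>2 / 9) \<le> japanese_bracket v powr (-3) * (v \<bullet> e)\<^sup>2"
        unfolding c_def by linarith
      then show ?thesis unfolding lower by (intro mult_left_mono nonneg)
    qed
  qed
  have "(\<integral>v. ?lower v \<partial>lborel) \<le> (\<integral>v. f v * (japanese_bracket v powr (-3) * (v \<bullet> e)\<^sup>2) \<partial>lborel)"
  proof (rule integral_mono)
    show "integrable lborel ?lower"
      by (intro integrable_mult_right Bochner_Integration.integrable_diff integrable_f ifA ie)
  qed (use integrable_weighted(1)[OF e] pt in auto)
  moreover have "(\<integral>v. ?lower v \<partial>lborel) = c * (1 - (\<integral>v. f v * indicator A v \<partial>lborel) - (1 / 9) * 3)"
  proof -
    have "(\<integral>v. f v - f v * indicator A v - (1 / 9) * (f v * (norm v)\<^sup>2) \<partial>lborel)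
      = (\<integral>v. f v - f v * indicator A v \<partial>lborel) - (\<integral>v. (1 / 9) * (f v * (norm v)\<^sup>2) \<partial>lborel)"
      by (intro Bochner_Integration.integral_diff integrable_mult_right Bochner_Integration.integrable_diff integrable_f ifA ie)
    also have "(\<integral>v. f v - f v * indicator A v \<partial>lborel) = 1 - (\<integral>v. f v * indicator A v \<partial>lborel)"
      using Bochner_Integration.integral_diff[OF integrable_f ifA] integral_f by simp
    also have "(\<integral>v. (1 / 9) * (f v * (norm v)\<^sup>2) \<partial>lborel) = (1 / 9) * 3"
      using ie(2) by (simp only: integral_mult_right_zero)
    finally show ?thesis by (simp only: integral_mult_right_zero)
  qed
  moreover have "c * (5 / 12) \<le> c * (1 - (\<integral>v. f v * indicator A v \<partial>lborel) - (1 / 9) * 3)"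
    using mA c by (intro mult_left_mono) auto
  moreover have "nondegeneracy Hbar = c * (5 / 12)"
    unfolding nondegeneracy_def c_def \<delta>_def \<mu>_def G_def Let_def ..
  ultimately show ?thesis by linarith
qed

end

section \<open>The weighted relative Fisher information\<close>

context normalized_density
begin

lemma second_moment_commute: "second_moment p q = second_moment q p"
  by (simp add: second_moment_def mult.commute)

lemma second_moment_bilinear: "bilinear second_moment"
proof -
  have add: "second_moment (p + p') q = second_moment p q + second_moment p' q" for p p' q
    unfolding second_moment_def
    by (subst Bochner_Integration.integral_add[symmetric, OF integrable_second_moment integrable_second_moment])
      (simp add: inner_add_right algebra_simps)
  have scale: "second_moment (r *\<^sub>R p) q = r *\<^sub>R second_moment p q" for r p q
    unfolding second_moment_def real_scaleR_def integral_mult_right_zero[symmetric]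
    by (simp add: mult_ac)
  have "linear (\<lambda>p. second_moment p q)" for q by (rule linearI) (rule add scale)+
  moreover have "second_moment p = (\<lambda>q. second_moment q p)" for p
    by (rule ext) (rule second_moment_commute)
  ultimately show ?thesis unfolding bilinear_def by (metis (no_types))
qed

definition weighted_norm_sq :: "(real^3 \<Rightarrow> real) \<Rightarrow> ennreal"
  where "weighted_norm_sq \<phi> = (\<integral>\<^sup>+v. ennreal (f v * japanese_bracket v powr (-3) * (\<phi> v)\<^sup>2) \<partial>lborel)"

lemma weighted_norm_sq_lincomb:
  assumes [measurable]: "\<phi> \<in> borel_measurable borel" "\<psi> \<in> borel_measurable borel"
  shows "weighted_norm_sq (\<lambda>v. a * \<phi> v + b * \<psi> v)
    \<le> ennreal (2 * a\<^sup>2) * weighted_norm_sq \<phi> + ennreal (2 * b\<^sup>2) * weighted_norm_sq \<psi>"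
proof -
  let ?W = "\<lambda>v. f v * japanese_bracket v powr (-3)"
  have W: "?W v \<ge> 0" for v using nonneg by simp
  have "weighted_norm_sq (\<lambda>v. a * \<phi> v + b * \<psi> v)
    \<le> (\<integral>\<^sup>+v. ennreal (2 * a\<^sup>2) * ennreal (?W v * (\<phi> v)\<^sup>2) + ennreal (2 * b\<^sup>2) * ennreal (?W v * (\<psi> v)\<^sup>2) \<partial>lborel)"
    unfolding weighted_norm_sq_def
  proof (rule nn_integral_mono)
    fix v
    have "0 \<le> (a * \<phi> v - b * \<psi> v)\<^sup>2" by simp
    then have "(a * \<phi> v + b * \<psi> v)\<^sup>2 \<le> 2 * (a * \<phi> v)\<^sup>2 + 2 * (b * \<psi> v)\<^sup>2"
      by (simp add: power2_eq_square algebra_simps)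
    then have "?W v * (a * \<phi> v + b * \<psi> v)\<^sup>2 \<le> ?W v * (2 * (a * \<phi> v)\<^sup>2 + 2 * (b * \<psi> v)\<^sup>2)"
      by (rule mult_left_mono[OF _ W])
    also have "\<dots> = 2 * a\<^sup>2 * (?W v * (\<phi> v)\<^sup>2) + 2 * b\<^sup>2 * (?W v * (\<psi> v)\<^sup>2)"
      by (simp add: power_mult_distrib algebra_simps)
    finally show "ennreal (?W v * (a * \<phi> v + b * \<psi> v)\<^sup>2)
      \<le> ennreal (2 * a\<^sup>2) * ennreal (?W v * (\<phi> v)\<^sup>2) + ennreal (2 * b\<^sup>2) * ennreal (?W v * (\<psi> v)\<^sup>2)"
      using W[of v] by (simp add: ennreal_leI flip: ennreal_mult ennreal_plus)
  qed
  also have "\<dots> = ennreal (2 * a\<^sup>2) * weighted_norm_sq \<phi> + ennreal (2 * b\<^sup>2) * weighted_norm_sq \<psi>"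
    unfolding weighted_norm_sq_def by (subst nn_integral_add) (auto simp: nn_integral_cmult)
  finally show ?thesis .
qed

lemma weighted_norm_sq_coordinate:
  assumes "norm p = 1"
  shows "weighted_norm_sq (\<lambda>v. v \<bullet> p) = ennreal (\<integral>v. f v * (japanese_bracket v powr (-3) * (v \<bullet> p)\<^sup>2) \<partial>lborel)"
    and "weighted_norm_sq (\<lambda>v. v \<bullet> p) \<le> 1"
    and "(\<integral>v. f v * (japanese_bracket v powr (-3) * (v \<bullet> p)\<^sup>2) \<partial>lborel) \<le> second_moment p p"
proof -
  show eq: "weighted_norm_sq (\<lambda>v. v \<bullet> p) = ennreal (\<integral>v. f v * (japanese_bracket v powr (-3) * (v \<bullet> p)\<^sup>2) \<partial>lborel)"
    unfolding weighted_norm_sq_def mult.assoc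
    by (rule nn_integral_eq_integral[OF integrable_weighted(1)[OF assms]]) (use nonneg in auto)
  have "(\<integral>v. f v * (japanese_bracket v powr (-3) * (v \<bullet> p)\<^sup>2) \<partial>lborel) \<le> (\<integral>v. f v \<partial>lborel)"
    by (rule integral_mono[OF integrable_weighted(1)[OF assms] integrable_f])
      (intro mult_right_le_one_le nonneg integrable_weighted(2)[OF assms], simp)
  then show "weighted_norm_sq (\<lambda>v. v \<bullet> p) \<le> 1" unfolding eq integral_f by (simp add: ennreal_le_1)
  show "(\<integral>v. f v * (japanese_bracket v powr (-3) * (v \<bullet> p)\<^sup>2) \<partial>lborel) \<le> second_moment p p"
    unfolding second_moment_def
  proof (rule integral_mono[OF integrable_weighted(1)[OF assms] integrable_second_moment])
    show "f v * (japanese_bracket v powr (-3) * (v \<bullet> p)\<^sup>2) \<le> f v * ((v \<bullet> p) * (v \<bullet> p))" for v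
      using integrable_weighted(3)[OF assms, of v] nonneg[of v] by (simp add: power2_eq_square mult_left_mono)
  qed
qed

text \<open>
  Let \<open>q, r\<close> be the other two axes and \<open>R\<^sub>a\<^sub>b = T\<^sub>b (F \<bullet> a) + v \<bullet> a\<close>.  From
  \<open>T\<^sub>b R\<^sub>a\<^sub>d - T\<^sub>d R\<^sub>a\<^sub>b = (T\<^sub>b - T\<^sub>d) (v \<bullet> a)\<close> and the lower bound \<open>c\<close> on the norm of \<open>v \<bullet> a\<close>, the gaps between
  the second moments are of the order of the residuals.  As the second moments add up to \<open>3\<close>, so is
  \<open>T\<^sub>q - 1\<close>, and \<open>F \<bullet> p + v \<bullet> p = (R\<^sub>p\<^sub>q + (T\<^sub>q - 1) (v \<bullet> p)) / T\<^sub>q\<close> with \<open>T\<^sub>q \<ge> c\<close> concludes.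
\<close>

lemma fisher_coordinate_le:
  fixes c k :: real
  assumes c: "c > 0" "\<And>e. norm e = 1 \<Longrightarrow> c \<le> (\<integral>v. f v * (japanese_bracket v powr (-3) * (v \<bullet> e)\<^sup>2) \<partial>lborel)"
    and E: "finite E" "card E = DIM(real^3)" "pairwise orthogonal E" "\<And>p. p \<in> E \<Longrightarrow> norm p = 1"
      "\<And>p q. p \<in> E \<Longrightarrow> q \<in> E \<Longrightarrow> p \<noteq> q \<Longrightarrow> second_moment p q = 0"
    and K: "16 * weighted_moment 5 f * entropy_dissipation f g = ennreal k" "k \<ge> 0"
    and p: "p \<in> E"
  shows "weighted_norm_sq (\<lambda>v. (score v + v) \<bullet> p) \<le> ennreal ((2 / c\<^sup>2 + 32 / c ^ 3) * k)"
proof -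
  have "card (E - {p}) = 2" using E(1,2) p by simp
  then obtain q r where qr: "E - {p} = {q, r}" "q \<noteq> r" by (auto simp: card_2_iff)
  then have q: "q \<in> E" "q \<noteq> p" and r: "r \<in> E" "r \<noteq> p" and Epqr: "E = {p, q, r}" using p by auto
  define T where "T e = second_moment e e" for e
  have Tc: "c \<le> T e" if "norm e = 1" for e
    using c(2)[OF that] weighted_norm_sq_coordinate(3)[OF that] by (simp add: T_def)
  have Tsum: "T p + T q + T r = 3"
  proof -
    have "(norm v)\<^sup>2 = (v \<bullet> p)\<^sup>2 + (v \<bullet> q)\<^sup>2 + (v \<bullet> r)\<^sup>2" for v
      using norm_squared_orthonormal_basis[OF E(1-4), of v] q r qr(2) unfolding Epqr by simp
    then have "f v * (norm v)\<^sup>2 = f v * ((v \<bullet> p) * (v \<bullet> p)) + f v * ((v \<bullet> q) * (v \<bullet> q)) + f v * ((v \<bullet> r) * (v \<bullet> r))" for v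
      by (simp add: power2_eq_square algebra_simps)
    then have "(\<integral>v. f v * (norm v)\<^sup>2 \<partial>lborel) = T p + T q + T r"
      unfolding T_def second_moment_def using integrable_second_moment by simp
    then show ?thesis using energy by (simp add: has_bochner_integral_iff)
  qed
  have Tpos: "0 < T p" "0 < T q" "0 < T r" using Tc[OF E(4)] c(1) p q(1) r(1) by (meson less_le_trans)+
  have T3: "(T e)\<^sup>2 \<le> 9" if "e \<in> E" for e
  proof -
    have "0 \<le> T e" "T e \<le> 3" using that Tsum Tpos unfolding Epqr by auto
    then have "(T e)\<^sup>2 \<le> 3\<^sup>2" by (intro power_mono)
    then show ?thesis by simp
  qed
  define R where "R a b v = T b * (score v \<bullet> a) + v \<bullet> a" for a b v
  have R_meas [measurable]: "R a b \<in> borel_measurable borel" for a b unfolding R_def[abs_def] by measurable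
  have R_le: "weighted_norm_sq (R a b) \<le> ennreal k" if "a \<in> E" "b \<in> E" "a \<noteq> b" for a b
  proof -
    have "a \<bullet> b = 0" using E(3) that unfolding pairwise_def orthogonal_def by blast
    then show ?thesis
      using score_deviation_integrated[OF E(4)[OF that(1)] E(4)[OF that(2)] _ E(5)[OF that]]
      unfolding weighted_norm_sq_def R_def T_def K(1) by simp
  qed
  have gap: "(T b - T d)\<^sup>2 * c \<le> 36 * k" if abd: "a \<in> E" "b \<in> E" "d \<in> E" "a \<noteq> b" "a \<noteq> d" for a b d
  proof -
    have "ennreal ((T b - T d)\<^sup>2 * c) \<le> ennreal ((T b - T d)\<^sup>2) * weighted_norm_sq (\<lambda>v. v \<bullet> a)"
      using c(2)[OF E(4)[OF abd(1)]] c(1) unfolding weighted_norm_sq_coordinate(1)[OF E(4)[OF abd(1)]]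
      by (subst ennreal_mult[symmetric]) (auto intro!: ennreal_leI mult_left_mono)
    also have "\<dots> = weighted_norm_sq (\<lambda>v. (T b - T d) * (v \<bullet> a))"
    proof -
      have "ennreal (f v * japanese_bracket v powr (-3) * ((T b - T d) * (v \<bullet> a))\<^sup>2)
          = ennreal ((T b - T d)\<^sup>2) * ennreal (f v * japanese_bracket v powr (-3) * (v \<bullet> a)\<^sup>2)" for v
        using nonneg[of v] by (subst ennreal_mult[symmetric]) (auto simp: power_mult_distrib mult_ac)
      then show ?thesis unfolding weighted_norm_sq_def by (simp add: nn_integral_cmult)
    qed
    also have "(\<lambda>v. (T b - T d) * (v \<bullet> a)) = (\<lambda>v. T b * R a d v + (- T d) * R a b v)"
      by (rule ext) (simp add: R_def algebra_simps)
    also have "weighted_norm_sq \<dots> \<le> ennreal (2 * (T b)\<^sup>2) * weighted_norm_sq (R a d) + ennreal (2 * (- T d)\<^sup>2) * weighted_norm_sq (R a b)"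
      by (rule weighted_norm_sq_lincomb) measurable
    also have "\<dots> \<le> ennreal (2 * 9) * ennreal k + ennreal (2 * 9) * ennreal k"
      using T3[OF abd(2)] T3[OF abd(3)] abd by (intro add_mono mult_mono R_le ennreal_leI) auto
    also have "\<dots> = ennreal (2 * 9 * k + 2 * 9 * k)"
      using K(2) by (simp only: ennreal_mult ennreal_plus mult_nonneg_nonneg zero_le_numeral)
    finally show ?thesis using K(2) by (subst (asm) ennreal_le_iff) auto
  qed
  have one: "(1 - T q)\<^sup>2 * c \<le> 16 * k"
  proof -
    have "9 * (1 - T q)\<^sup>2 = ((T p - T q) + (T r - T q))\<^sup>2"
    proof -
      have "(T p - T q) + (T r - T q) = 3 * (1 - T q)" using Tsum by simp
      then show ?thesis by (simp only: power_mult_distrib) simp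
    qed
    also have "\<dots> \<le> 2 * (T p - T q)\<^sup>2 + 2 * (T r - T q)\<^sup>2"
    proof -
      have "0 \<le> ((T p - T q) - (T r - T q))\<^sup>2" by simp
      then show ?thesis by (simp add: power2_eq_square algebra_simps)
    qed
    finally have "9 * (1 - T q)\<^sup>2 * c \<le> (2 * (T p - T q)\<^sup>2 + 2 * (T r - T q)\<^sup>2) * c"
      using c(1) by (intro mult_right_mono) auto
    also have "\<dots> = 2 * ((T p - T q)\<^sup>2 * c) + 2 * ((T r - T q)\<^sup>2 * c)" by (simp add: algebra_simps)
    also have "\<dots> \<le> 2 * (36 * k) + 2 * (36 * k)"
      by (intro add_mono mult_left_mono gap[of r p q] gap[of p r q]) (use p q r qr in auto)
    finally show ?thesis by (simp add: mult_ac)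
  qed
  have Tq: "c \<le> T q" "T q > 0" using Tc[OF E(4)[OF q(1)]] Tpos by auto
  have inv: "1 / (T q)\<^sup>2 \<le> 1 / c\<^sup>2"
    using Tq c(1) by (intro divide_left_mono power_mono) auto
  have "(\<lambda>v. (score v + v) \<bullet> p) = (\<lambda>v. (1 / T q) * R p q v + ((T q - 1) / T q) * (v \<bullet> p))"
    using Tq(2) by (intro ext) (simp add: R_def inner_add_left field_simps)
  then have "weighted_norm_sq (\<lambda>v. (score v + v) \<bullet> p)
    \<le> ennreal (2 * (1 / T q)\<^sup>2) * weighted_norm_sq (R p q) + ennreal (2 * ((T q - 1) / T q)\<^sup>2) * weighted_norm_sq (\<lambda>v. v \<bullet> p)"
    by (simp only:) (rule weighted_norm_sq_lincomb; measurable)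
  also have "\<dots> \<le> ennreal (2 / c\<^sup>2) * ennreal k + ennreal (32 * k / c ^ 3) * 1"
  proof (intro add_mono mult_mono ennreal_leI R_le weighted_norm_sq_coordinate E p q)
    show "2 * (1 / T q)\<^sup>2 \<le> 2 / c\<^sup>2" using inv by (simp add: power_divide)
    have "2 * ((T q - 1) / T q)\<^sup>2 = 2 * ((1 - T q)\<^sup>2 * c) / c * (1 / (T q)\<^sup>2)"
      using c(1) by (simp add: power_divide power2_commute)
    also have "\<dots> \<le> 2 * (16 * k) / c * (1 / c\<^sup>2)"
    proof (rule mult_mono)
      show "2 * ((1 - T q)\<^sup>2 * c) / c \<le> 2 * (16 * k) / c"
        using one c(1) by (intro divide_right_mono mult_left_mono) auto
    qed (use inv c(1) K(2) in auto)
    also have "\<dots> = 32 * k / c ^ 3" by (simp add: power2_eq_square power3_eq_cube)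
    finally show "2 * ((T q - 1) / T q)\<^sup>2 \<le> 32 * k / c ^ 3" .
  qed (use q in auto)
  also have "\<dots> = ennreal (2 / c\<^sup>2 * k + 32 * k / c ^ 3)"
    using K(2) c(1) by (simp flip: ennreal_mult ennreal_plus)
  also have "2 / c\<^sup>2 * k + 32 * k / c ^ 3 = (2 / c\<^sup>2 + 32 / c ^ 3) * k" by (simp add: algebra_simps)
  finally show ?thesis .
qed

lemma weighted_relative_fisher_le:
  fixes c :: real
  assumes c: "c > 0" "\<And>e. norm e = 1 \<Longrightarrow> c \<le> (\<integral>v. f v * (japanese_bracket v powr (-3) * (v \<bullet> e)\<^sup>2) \<partial>lborel)"
  shows "weighted_relative_fisher f g
    \<le> ennreal (3 * (2 / c\<^sup>2 + 32 / c ^ 3)) * (16 * weighted_moment 5 f * entropy_dissipation f g)"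
proof (cases "16 * weighted_moment 5 f * entropy_dissipation f g")
  case top
  have "3 * (2 / c\<^sup>2 + 32 / c ^ 3) > 0" using c(1) by (simp add: add_pos_pos)
  then show ?thesis unfolding top by (simp add: ennreal_mult_top)
next
  case (real k)
  obtain E where E: "finite E" "card E = DIM(real^3)" "pairwise orthogonal E" "\<And>p. p \<in> E \<Longrightarrow> norm p = 1"
    "\<And>p q. p \<in> E \<Longrightarrow> q \<in> E \<Longrightarrow> p \<noteq> q \<Longrightarrow> second_moment p q = 0"
    by (rule symmetric_bilinear_orthonormal_basis[OF second_moment_bilinear second_moment_commute])
      (rule that, assumption+)
  have "weighted_relative_fisher f g = (\<integral>\<^sup>+v. (\<Sum>p\<in>E. ennreal (f v * japanese_bracket v powr (-3) * ((score v + v) \<bullet> p)\<^sup>2)) \<partial>lborel)"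
    unfolding weighted_relative_fisher_def
  proof (rule nn_integral_cong)
    fix v
    have "f v * (norm (g v /\<^sub>R f v + v))\<^sup>2 * japanese_bracket v powr (-3)
      = (\<Sum>p\<in>E. f v * japanese_bracket v powr (-3) * ((score v + v) \<bullet> p)\<^sup>2)"
      using norm_squared_orthonormal_basis[OF E(1-4), of "g v /\<^sub>R f v + v"]
      unfolding score_def sum_distrib_left[symmetric] by (simp only: mult_ac)
    then show "ennreal (f v * (norm (g v /\<^sub>R f v + v))\<^sup>2 * japanese_bracket v powr (-3))
      = (\<Sum>p\<in>E. ennreal (f v * japanese_bracket v powr (-3) * ((score v + v) \<bullet> p)\<^sup>2))"
      using nonneg[of v] by (simp add: sum_ennreal)
  qed
  also have "\<dots> = (\<Sum>p\<in>E. weighted_norm_sq (\<lambda>v. (score v + v) \<bullet> p))"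
    unfolding weighted_norm_sq_def by (rule nn_integral_sum) measurable
  also have "\<dots> \<le> (\<Sum>p\<in>E. ennreal ((2 / c\<^sup>2 + 32 / c ^ 3) * k))"
    by (intro sum_mono fisher_coordinate_le[OF c E]) (use real in auto)
  also have "\<dots> = ennreal (3 * ((2 / c\<^sup>2 + 32 / c ^ 3) * k))"
    using E(2) real(1) c(1) by (subst sum_ennreal) auto
  also have "\<dots> = ennreal (3 * (2 / c\<^sup>2 + 32 / c ^ 3)) * ennreal k"
    using real(1) c(1) by (subst ennreal_mult[symmetric]) (auto simp: mult.assoc)
  finally show ?thesis unfolding real(2) .
qed

end

theorem theorem1:
  "\<forall>Hbar::real. \<exists>C::real. C > 0 \<and>
    (\<forall>(f :: real^3 \<Rightarrow> real) (g :: real^3 \<Rightarrow> real^3).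
       (\<forall>v. f v \<ge> 0) \<longrightarrow>
       has_weak_gradient f g \<longrightarrow>
       has_bochner_integral lborel f 1 \<longrightarrow>
       has_bochner_integral lborel (\<lambda>v. f v *\<^sub>R v) 0 \<longrightarrow>
       has_bochner_integral lborel (\<lambda>v. f v * (norm v)\<^sup>2) 3 \<longrightarrow>
       entropy_le f Hbar \<longrightarrow>
       entropy_dissipation f g
         \<ge> ennreal C * inverse (weighted_moment 5 f) * weighted_relative_fisher f g)"
proof
  fix Hbar :: real
  define c where "c = nondegeneracy Hbar"
  define A where "A = 3 * (2 / c\<^sup>2 + 32 / c ^ 3)"
  have c: "c > 0" unfolding c_def by (rule nondegeneracy_pos)
  then have A: "A > 0" unfolding A_def by (simp add: add_pos_pos)
  show "\<exists>C::real. C > 0 \<and>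
    (\<forall>(f :: real^3 \<Rightarrow> real) (g :: real^3 \<Rightarrow> real^3).
       (\<forall>v. f v \<ge> 0) \<longrightarrow>
       has_weak_gradient f g \<longrightarrow>
       has_bochner_integral lborel f 1 \<longrightarrow>
       has_bochner_integral lborel (\<lambda>v. f v *\<^sub>R v) 0 \<longrightarrow>
       has_bochner_integral lborel (\<lambda>v. f v * (norm v)\<^sup>2) 3 \<longrightarrow>
       entropy_le f Hbar \<longrightarrow>
       entropy_dissipation f g
         \<ge> ennreal C * inverse (weighted_moment 5 f) * weighted_relative_fisher f g)"
  proof (intro exI[of _ "1 / (16 * A)"] conjI allI impI)
    show "1 / (16 * A) > 0" using A by simp
    fix f :: "real^3 \<Rightarrow> real" and g :: "real^3 \<Rightarrow> real^3"
    assume asm: "\<forall>v. f v \<ge> 0" "has_weak_gradient f g" "has_bochner_integral lborel f 1"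
      "has_bochner_integral lborel (\<lambda>v. f v *\<^sub>R v) 0"
      "has_bochner_integral lborel (\<lambda>v. f v * (norm v)\<^sup>2) 3" and H: "entropy_le f Hbar"
    interpret normalized_density f g by unfold_locales (use asm in auto)
    let ?M = "weighted_moment 5 f" and ?D = "entropy_dissipation f g"
    have "ennreal (1 / (16 * A)) * inverse ?M * weighted_relative_fisher f g
      \<le> ennreal (1 / (16 * A)) * inverse ?M * (ennreal A * (16 * ?M * ?D))"
      unfolding A_def
      by (intro mult_left_mono weighted_relative_fisher_le c)
        (use nondegeneracy_le[OF H] in \<open>auto simp: c_def\<close>)
    also have "\<dots> = (ennreal (1 / (16 * A)) * ennreal A * 16) * (inverse ?M * ?M) * ?D"
      by (simp only: mult_ac)
    also have "ennreal (1 / (16 * A)) * ennreal A * 16 = 1"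
    proof -
      have "ennreal (x * A * 16) = ennreal x * ennreal A * 16" if "x \<ge> 0" for x
        using that A by (simp add: ennreal_mult)
      from this[of "1 / (16 * A)"] show ?thesis using A by simp
    qed
    also have "1 * (inverse ?M * ?M) * ?D \<le> 1 * ?D"
    proof (rule mult_right_mono)
      show "1 * (inverse ?M * ?M) \<le> 1"
      proof (cases ?M)
        case (real r)
        have "inverse (ennreal r) * ennreal r \<le> 1"
          using real(1) by (cases "r = 0") (auto simp: inverse_ennreal simp flip: ennreal_mult)
        then show ?thesis by (simp only: real(2) mult_1_left)
      qed simp
    qed simp
    finally show "ennreal (1 / (16 * A)) * inverse ?M * weighted_relative_fisher f g \<le> ?D" by simp
  qed
qed

end
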